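(* Let $\{S_i\}_{i=1}^N$ be an IFS of contractive similitudes with the open set condition, and let $K$ be the self-similar set. Let $0<\lambda<1$ and suppose $\{Z_n\}_{n=0}^\infty$ is a $\lambda$-quasi-natural random walk ($\lambda$-QNRW) on the augmented tree $(X,\mathfrak E)$ associated with a set of positive probability weights $\{p_i\}_{i=1}^N$. Then the hitting distribution $\nu_\vartheta$ (transported to $K$ by the canonical identification of the Martin boundary with $K$) is the self-similar measure $\mu$ with weights $\{p_i\}_{i=1}^N$ on $K$.
   Context: IFS and levels. $N\ge2$; $\{S_i\}_{i=1}^N$ are contractive similitudes of $\mathbb R^d$ with ratios $r_i\in(0,1)$, $r=\min_ir_i$; $K$ is the unique nonempty compact set with $K=\bigcup_iS_i(K)$. Open set condition (OSC): there is a nonempty bounded open $U$ with $S_i(U)\subset U$ and $S_i(U)\cap S_j(U)=\emptyset$ for $i\neq j$. The self-similar measure with weights $\{p_i\}$ is the unique Borel probability measure $\mu$ with $\mu(\cdot)=\sum_ip_i\,\mu(S_i^{-1}(\cdot))$. For a word $x=i_1\cdots i_k$ over $\{1,\dots,N\}$: $S_x=S_{i_1}\circ\cdots\circ S_{i_k}$, $r_x=r_{i_1}\cdots r_{i_k}$, $p_x=p_{i_1}\cdots p_{i_k}$ ($r_\vartheta=p_\vartheta=1$ for the empty word $\vartheta$). $\mathcal J_0=\{\vartheta\}$, $\mathcal J_n=\{x=i_1\cdots i_k: r_x\le r^n<r_{i_1\cdots i_{k-1}}\}$ for $n\ge1$ (pairwise disjoint), $X=\bigcup_{n\ge0}\mathcal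 J_n$, $|x|=n$ for $x\in\mathcal J_n$. For $x\in\mathcal J_n$, $n\ge1$, the parent $x^-$ is the unique prefix of $x$ in $\mathcal J_{n-1}$. Augmented tree $(X,\mathfrak E)$: $\mathfrak E=\mathfrak E_v\cup\mathfrak E_h$, $\mathfrak E_v=\{(x,y):x=y^-\text{ or }y=x^-\}$ and, for a fixed $\gamma>0$, $\mathfrak E_h=\{(x,y):x\ne y,\ |x|=|y|,\ \inf_{\xi,\eta\in K}|S_x(\xi)-S_y(\eta)|\le\gamma r^{|x|}\}$. $\lambda$-QNRW with weights $\{p_i\}$: Markov chain with $P(x,y)=c(x,y)/m(x)$, $m(x)=\sum_yc(x,y)$, $c$ symmetric and nonnegative, with $c(x,x^-)=p_x\lambda^{-m}$ for $x\in\mathcal J_m$, $m\ge1$; $c(x,y)\asymp c(x,x^-)$ for $(x,y)\in\mathfrak E_h$ (two-sided bounds with positive constants independent of $x,y$); $c(x,y)=0$ if $(x,y)\notin\mathfrak E$. This walk is irreducible and transient. Hitting distribution. With $G=\sum_{k\ge0}P^k$ and Martin kernel $K(x,y)=G(x,y)/G(\vartheta,y)$, the Martin compactification $\widehat X$ is the minimal compactification of $X$ to which all $K(x,\cdot)$ extend continuously, $\mathcal M=\widehat X\setminus X$. $\mathcal M$ is canonically homeomorphic to $K$: each geodesic ray $(x_n)$ of the graph starting at $\vartheta$ converges in $\widehat X$, and its limit corresponds to the unique point of $\bigcap_nS_{x_n}(K)$. The chain converges a.s. to an $\mathcal M$-valued random variable $Z_\infty$, and $\nu_\vartheta$ is the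 law of $Z_\infty$ for the chain started at $\vartheta$. *)

theory Defs
  imports "HOL-Probability.Probability" "HOL-Library.Sublist"
begin

section \<open>Iterated function systems\<close>

definition contractive_similitude :: "('a::euclidean_space \<Rightarrow> 'a) \<Rightarrow> real \<Rightarrow> bool" where
  "contractive_similitude f \<rho> \<longleftrightarrow>
     0 < \<rho> \<and> \<rho> < 1 \<and> (\<forall>x y. dist (f x) (f y) = \<rho> * dist x y)"

definition open_set_condition :: "nat \<Rightarrow> (nat \<Rightarrow> 'a::euclidean_space \<Rightarrow> 'a) \<Rightarrow> bool" where
  "open_set_condition N S \<longleftrightarrow>
     (\<exists>U. U \<noteq> {} \<and> bounded U \<and> open U \<and> (\<forall>i\<in>{1..N}. S i ` U \<subseteq> U) \<and>
          (\<forall>i\<in>{1..N}. \<forall>j\<in>{1..N}. i \<noteq> j \<longrightarrow> S i ` U \<inter> S j ` U = {}))"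

definition self_similar_set ::
    "nat \<Rightarrow> (nat \<Rightarrow> 'a::euclidean_space \<Rightarrow> 'a) \<Rightarrow> 'a set \<Rightarrow> bool" where
  "self_similar_set N S K \<longleftrightarrow> K \<noteq> {} \<and> compact K \<and> K = (\<Union>i\<in>{1..N}. S i ` K)"

definition self_similar_measure ::
    "nat \<Rightarrow> (nat \<Rightarrow> 'a::euclidean_space \<Rightarrow> 'a) \<Rightarrow> (nat \<Rightarrow> real) \<Rightarrow> 'a measure \<Rightarrow> bool" where
  "self_similar_measure N S p \<mu> \<longleftrightarrow>
     sets \<mu> = sets borel \<and> prob_space \<mu> \<and>
     (\<forall>A\<in>sets borel. measure \<mu> A = (\<Sum>i=1..N. p i * measure \<mu> (S i -` A)))"

section \<open>Words and levels\<close>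

text \<open>Words over the alphabet \<open>{1..N}\<close> are lists; the empty word is \<open>[]\<close>.\<close>

definition word_map :: "(nat \<Rightarrow> 'a \<Rightarrow> 'a) \<Rightarrow> nat list \<Rightarrow> 'a \<Rightarrow> 'a" where
  "word_map S w = foldr (\<circ>) (map S w) id"

definition word_weight :: "(nat \<Rightarrow> real) \<Rightarrow> nat list \<Rightarrow> real" where
  "word_weight q w = prod_list (map q w)"

definition min_ratio :: "nat \<Rightarrow> (nat \<Rightarrow> real) \<Rightarrow> real" where
  "min_ratio N r = Min (r ` {1..N})"

definition level_set :: "nat \<Rightarrow> (nat \<Rightarrow> real) \<Rightarrow> nat \<Rightarrow> nat list set" where
  "level_set N r n =
     (if n = 0 then {[]}
      else {w. w \<noteq> [] \<and> set w \<subseteq> {1..N} \<and> word_weight r w \<le> min_ratio N r ^ n \<and>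
               min_ratio N r ^ n < word_weight r (butlast w)})"

definition tree_vertices :: "nat \<Rightarrow> (nat \<Rightarrow> real) \<Rightarrow> nat list set" where
  "tree_vertices N r = (\<Union>n. level_set N r n)"

definition level :: "nat \<Rightarrow> (nat \<Rightarrow> real) \<Rightarrow> nat list \<Rightarrow> nat" where
  "level N r x = (THE n. x \<in> level_set N r n)"

text \<open>Only meaningful for vertices of level at least 1.\<close>

definition parent :: "nat \<Rightarrow> (nat \<Rightarrow> real) \<Rightarrow> nat list \<Rightarrow> nat list" where
  "parent N r x = (THE u. prefix u x \<and> u \<in> level_set N r (level N r x - 1))"

section \<open>The augmented tree\<close>

definition vertical_edges :: "nat \<Rightarrow> (nat \<Rightarrow> real) \<Rightarrow> (nat list \<times> nat list) set" where
  "vertical_edges N r =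
     {(x, y). x \<in> tree_vertices N r \<and> y \<in> tree_vertices N r \<and>
        (level N r y \<ge> 1 \<and> x = parent N r y \<or> level N r x \<ge> 1 \<and> y = parent N r x)}"

definition horizontal_edges ::
    "nat \<Rightarrow> (nat \<Rightarrow> 'a::euclidean_space \<Rightarrow> 'a) \<Rightarrow> (nat \<Rightarrow> real) \<Rightarrow> 'a set \<Rightarrow> real
     \<Rightarrow> (nat list \<times> nat list) set" where
  "horizontal_edges N S r K \<gamma> =
     {(x, y). x \<in> tree_vertices N r \<and> y \<in> tree_vertices N r \<and> x \<noteq> y \<and>
        level N r x = level N r y \<and>
        (INF (\<xi>, \<eta>)\<in>K \<times> K. dist (word_map S x \<xi>) (word_map S y \<eta>))
          \<le> \<gamma> * min_ratio N r ^ level N r x}"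

definition tree_edges ::
    "nat \<Rightarrow> (nat \<Rightarrow> 'a::euclidean_space \<Rightarrow> 'a) \<Rightarrow> (nat \<Rightarrow> real) \<Rightarrow> 'a set \<Rightarrow> real
     \<Rightarrow> (nat list \<times> nat list) set" where
  "tree_edges N S r K \<gamma> = vertical_edges N r \<union> horizontal_edges N S r K \<gamma>"

definition graph_dist :: "('v \<times> 'v) set \<Rightarrow> 'v \<Rightarrow> 'v \<Rightarrow> nat" where
  "graph_dist E x y = (LEAST n. (x, y) \<in> E ^^ n)"

definition geodesic_ray :: "('v \<times> 'v) set \<Rightarrow> 'v \<Rightarrow> (nat \<Rightarrow> 'v) \<Rightarrow> bool" where
  "geodesic_ray E o' x \<longleftrightarrow>
     x 0 = o' \<and> (\<forall>n. (x n, x (Suc n)) \<in> E) \<and>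
     (\<forall>m n. m \<le> n \<longrightarrow> graph_dist E (x m) (x n) = n - m)"

section \<open>Quasi-natural random walks\<close>

definition qnrw_conductance ::
    "nat \<Rightarrow> (nat \<Rightarrow> 'a::euclidean_space \<Rightarrow> 'a) \<Rightarrow> (nat \<Rightarrow> real) \<Rightarrow> 'a set \<Rightarrow> real
     \<Rightarrow> (nat \<Rightarrow> real) \<Rightarrow> real \<Rightarrow> (nat list \<Rightarrow> nat list \<Rightarrow> real) \<Rightarrow> bool" where
  "qnrw_conductance N S r K \<gamma> p lam c \<longleftrightarrow>
     (\<forall>x\<in>tree_vertices N r. \<forall>y\<in>tree_vertices N r.
        c x y = c y x \<and> 0 \<le> c x y \<and> ((x, y) \<notin> tree_edges N S r K \<gamma> \<longrightarrow> c x y = 0)) \<and>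
     (\<forall>m\<ge>1. \<forall>x\<in>level_set N r m. c x (parent N r x) = word_weight p x / lam ^ m) \<and>
     (\<exists>a>0. \<exists>b>0. \<forall>(x, y)\<in>horizontal_edges N S r K \<gamma>.
        a * c x (parent N r x) \<le> c x y \<and> c x y \<le> b * c x (parent N r x))"

definition transition :: "'v set \<Rightarrow> ('v \<Rightarrow> 'v \<Rightarrow> real) \<Rightarrow> 'v \<Rightarrow> 'v \<Rightarrow> real" where
  "transition X c x y = c x y / (\<Sum>\<^sub>\<infinity>z\<in>X. c x z)"

definition markov_chain ::
    "'w measure \<Rightarrow> 'v set \<Rightarrow> ('v \<Rightarrow> 'v \<Rightarrow> real) \<Rightarrow> 'v \<Rightarrow> (nat \<Rightarrow> 'w \<Rightarrow> 'v) \<Rightarrow> bool" where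
  "markov_chain M X P o' Z \<longleftrightarrow>
     prob_space M \<and> (\<forall>n. Z n \<in> measurable M (count_space X)) \<and>
     (AE \<omega> in M. Z 0 \<omega> = o') \<and>
     (\<forall>n x. (\<forall>k\<le>Suc n. x k \<in> X) \<longrightarrow>
        measure M {\<omega> \<in> space M. \<forall>k\<le>Suc n. Z k \<omega> = x k} =
        measure M {\<omega> \<in> space M. \<forall>k\<le>n. Z k \<omega> = x k} * P (x n) (x (Suc n)))"

section \<open>Martin compactification and hitting distribution\<close>

primrec step_prob :: "'v set \<Rightarrow> ('v \<Rightarrow> 'v \<Rightarrow> real) \<Rightarrow> nat \<Rightarrow> 'v \<Rightarrow> 'v \<Rightarrow> real" where
  "step_prob X P 0 x y = (if x = y then 1 else 0)"
| "step_prob X P (Suc n) x y = (\<Sum>\<^sub>\<infinity>z\<in>X. P x z * step_prob X P n z y)"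

text \<open>
  The series is meaningful for transient \<open>P\<close>; for the walks considered here, which are
  transient on a locally finite graph, neither it nor the sums above take a default value.
\<close>

definition green :: "'v set \<Rightarrow> ('v \<Rightarrow> 'v \<Rightarrow> real) \<Rightarrow> 'v \<Rightarrow> 'v \<Rightarrow> real" where
  "green X P x y = (\<Sum>n. step_prob X P n x y)"

definition martin_kernel :: "'v set \<Rightarrow> ('v \<Rightarrow> 'v \<Rightarrow> real) \<Rightarrow> 'v \<Rightarrow> 'v \<Rightarrow> 'v \<Rightarrow> real" where
  "martin_kernel X P o' x y = green X P x y / green X P o' y"

definition compactification :: "'v set \<Rightarrow> 't topology \<Rightarrow> ('v \<Rightarrow> 't) \<Rightarrow> bool" where
  "compactification X T \<iota> \<longleftrightarrow>
     compact_space T \<and> Hausdorff_space T \<and>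
     embedding_map (discrete_topology X) T \<iota> \<and> T closure_of (\<iota> ` X) = topspace T"

definition kernel_extends ::
    "'v set \<Rightarrow> ('v \<Rightarrow> 'v \<Rightarrow> real) \<Rightarrow> 'v \<Rightarrow> 't topology \<Rightarrow> ('v \<Rightarrow> 't) \<Rightarrow> bool" where
  "kernel_extends X P o' T \<iota> \<longleftrightarrow>
     (\<forall>x\<in>X. \<exists>f. continuous_map T euclideanreal f \<and>
        (\<forall>y\<in>X. f (\<iota> y) = martin_kernel X P o' x y))"

text \<open>
  Minimality is tested only against compactifications carried by the same type. This loses
  nothing: the smallest compactification to which the kernels extend is a quotient of every
  other one, so it has a copy inside any type that carries some such compactification.
\<close>

definition martin_compactification ::
    "'v set \<Rightarrow> ('v \<Rightarrow> 'v \<Rightarrow> real) \<Rightarrow> 'v \<Rightarrow> 't topology \<Rightarrow> ('v \<Rightarrow> 't) \<Rightarrow> bool" where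
  "martin_compactification X P o' T \<iota> \<longleftrightarrow>
     compactification X T \<iota> \<and> kernel_extends X P o' T \<iota> \<and>
     (\<forall>(T' :: 't topology) \<iota>'. compactification X T' \<iota>' \<and> kernel_extends X P o' T' \<iota>' \<longrightarrow>
        (\<exists>h. continuous_map T' T h \<and> (\<forall>y\<in>X. h (\<iota>' y) = \<iota> y)))"

definition boundary :: "'v set \<Rightarrow> 't topology \<Rightarrow> ('v \<Rightarrow> 't) \<Rightarrow> 't topology" where
  "boundary X T \<iota> = subtopology T (topspace T - \<iota> ` X)"

text \<open>
  The ray condition determines \<open>\<kappa>\<close>: every point of \<open>K\<close> is the point
  selected by some geodesic ray from the root, so it fixes the inverse of the bijection.
\<close>

definition canonical_identification ::
    "nat \<Rightarrow> (nat \<Rightarrow> 'a::euclidean_space \<Rightarrow> 'a) \<Rightarrow> (nat \<Rightarrow> real) \<Rightarrow> 'a set \<Rightarrow> real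
     \<Rightarrow> 't topology \<Rightarrow> (nat list \<Rightarrow> 't) \<Rightarrow> ('t \<Rightarrow> 'a) \<Rightarrow> bool" where
  "canonical_identification N S r K \<gamma> T \<iota> \<kappa> \<longleftrightarrow>
     homeomorphic_map (boundary (tree_vertices N r) T \<iota>) (top_of_set K) \<kappa> \<and>
     (\<forall>x. geodesic_ray (tree_edges N S r K \<gamma>) [] x \<longrightarrow>
        (\<exists>\<zeta>\<in>topspace (boundary (tree_vertices N r) T \<iota>).
           limitin T (\<lambda>n. \<iota> (x n)) \<zeta> sequentially \<and> (\<Inter>n. word_map S (x n) ` K) = {\<kappa> \<zeta>}))"

definition borel_of_topology :: "'t topology \<Rightarrow> 't measure" where
  "borel_of_topology T = sigma (topspace T) {U. openin T U}"

definition hitting_distribution ::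
    "'w measure \<Rightarrow> (nat \<Rightarrow> 'w \<Rightarrow> 'v) \<Rightarrow> 'v set \<Rightarrow> 't topology \<Rightarrow> ('v \<Rightarrow> 't) \<Rightarrow> 't measure \<Rightarrow> bool"
  where
  "hitting_distribution M Z X T \<iota> \<nu> \<longleftrightarrow>
     (\<exists>Zinf \<in> measurable M (borel_of_topology (boundary X T \<iota>)).
        (AE \<omega> in M. limitin T (\<lambda>n. \<iota> (Z n \<omega>)) (Zinf \<omega>) sequentially) \<and>
        \<nu> = distr M (borel_of_topology (boundary X T \<iota>)) Zinf)"

end

theory Submission
  imports Defs
begin

text \<open>
  The proof compares two ways of producing a random vertex of level \<open>n\<close>, both of which give mass
  \<open>p\<^sub>x\<close> to the vertex \<open>x\<close>.

  The first is the walk, stopped when it first leaves the levels below \<open>n\<close> (\<open>exit_law\<close>). Let \<open>h\<close> be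
  harmonic on those levels with prescribed values on level \<open>n\<close>; optional stopping makes \<open>h []\<close> the mean
  of these values under the exit law. Let \<open>A m\<close> be the mean of \<open>h\<close> over level \<open>m\<close> with weights \<open>p\<^sub>x\<close>,
  and sum the equation \<open>\<Sum>y. c x y * (h y - h x) = 0\<close> over the vertices \<open>x\<close> of level \<open>m\<close>. The
  horizontal terms cancel, because \<open>c\<close> is symmetric. The vertical terms involve only \<open>A (m - 1)\<close>, \<open>A m\<close> and \<open>A (m + 1)\<close>, because the
  conductance of a vertical edge is a power of \<open>lam\<close> times the weight of its lower end and the
  weights of the children of a vertex add up to its own weight. So the flow from one level to the
  next is conserved. Nothing flows into the root from above; hence all flows are 0, all \<open>A m\<close> agree, and
  \<open>h [] = A 0 = A n\<close> (\<open>level_mean_constant\<close>).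

  The second is a random address: an infinite word with independent letters of law \<open>p\<close>. It has
  exactly one prefix in each level, which is \<open>x\<close> with probability \<open>p\<^sub>x\<close> (\<open>integral_cut\<close>).

  Now let \<open>f\<close> be a Lipschitz function on the ambient space, with values in \<open>[0, 1]\<close>; the integrals of
  such functions determine a probability measure (\<open>measure_eqI_lipschitz\<close>). Let \<open>F\<close> be a continuous
  extension to the whole compactification of \<open>f \<circ> \<kappa>\<close>, which lives on the boundary. By the
  above, \<open>F\<close> has the same mean at the exit vertex of the walk and at the prefix of a random address.
  Let \<open>n\<close> tend to infinity. The walk converges to its limit on the boundary, and the mean becomes
  that of \<open>f \<circ> \<kappa>\<close> under the hitting distribution. The prefixes of an address form a geodesic ray
  (\<open>geodesic_ray_cut\<close>), whose limit \<open>\<kappa>\<close> sends to the point of \<open>K\<close> with that address; so the mean becomes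
  that of \<open>f\<close> under the law of a random coded point, which is the self-similar measure
  (\<open>integral_words_tendsto\<close>). Trajectories of the walk are thus never compared with rays one by one,
  only through the numbers that both produce on each level.
\<close>

section \<open>Words, cut sets and parents\<close>

lemma word_weight_simps [simp]:
  "word_weight q [] = 1"
  "word_weight q (i # w) = q i * word_weight q w"
  "word_weight q (u @ v) = word_weight q u * word_weight q v"
  by (simp_all add: word_weight_def)

lemma word_map_simps [simp]:
  "word_map S [] = id"
  "word_map S (i # w) = S i \<circ> word_map S w"
  by (simp_all add: word_map_def)

lemma word_map_append: "word_map S (u @ v) = word_map S u \<circ> word_map S v"
  by (induction u) (auto simp: comp_assoc)

lemma prefix_of_stake: "j \<le> k \<Longrightarrow> prefix (stake j s) (stake k s)"
  by (metis prefixI le_add_diff_inverse stake_add)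

lemma set_stake_subset: "set (stake k s) \<subseteq> sset s"
  by (metis stake_sdrop sset_shift Un_upper1)

locale contraction_ratios =
  fixes N :: nat and r :: "nat \<Rightarrow> real"
  assumes N_pos: "1 \<le> N"
    and ratio_pos: "\<And>i. i \<in> {1..N} \<Longrightarrow> 0 < r i"
    and ratio_less_1: "\<And>i. i \<in> {1..N} \<Longrightarrow> r i < 1"
begin

abbreviation \<rho> :: real where "\<rho> \<equiv> min_ratio N r"
abbreviation J :: "nat \<Rightarrow> nat list set" where "J \<equiv> level_set N r"
abbreviation X :: "nat list set" where "X \<equiv> tree_vertices N r"

lemma rho_le: "i \<in> {1..N} \<Longrightarrow> \<rho> \<le> r i"
  by (simp add: min_ratio_def)

lemma rho_attained: "\<exists>i\<in>{1..N}. \<rho> = r i"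
proof -
  have "\<rho> \<in> r ` {1..N}" unfolding min_ratio_def using N_pos by (intro Min_in) auto
  then show ?thesis by auto
qed

lemma rho_pos: "0 < \<rho>" and rho_less_1: "\<rho> < 1"
  using rho_attained ratio_pos ratio_less_1 by metis+

lemma weight_pos: "set w \<subseteq> {1..N} \<Longrightarrow> 0 < word_weight r w"
  by (induction w) (auto intro!: mult_pos_pos ratio_pos)

lemma weight_le_1: "set w \<subseteq> {1..N} \<Longrightarrow> word_weight r w \<le> 1"
proof (induction w)
  case (Cons i w)
  then have "r i * word_weight r w \<le> 1 * 1"
    by (intro mult_mono) (auto simp: less_imp_le ratio_less_1 weight_pos)
  then show ?case by simp
qed simp

lemma weight_antimono:
  assumes "prefix u v" "set v \<subseteq> {1..N}" shows "word_weight r v \<le> word_weight r u"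
proof -
  obtain t where v: "v = u @ t" using assms(1) by (auto simp: prefix_def)
  then show ?thesis
    using assms(2) weight_le_1[of t] weight_pos[of u] mult_left_le[of "word_weight r t" "word_weight r u"]
    by auto
qed

text \<open>Putting level 0 into the same form as the others: no nonempty word has a proper prefix of
  weight greater than 1.\<close>

lemma level_set_iff:
  "w \<in> J n \<longleftrightarrow> set w \<subseteq> {1..N} \<and> word_weight r w \<le> \<rho> ^ n \<and>
     (w \<noteq> [] \<longrightarrow> \<rho> ^ n < word_weight r (butlast w))"
proof (cases "n = 0")
  case True
  have "\<not> 1 < word_weight r (butlast w)" if "set w \<subseteq> {1..N}"
    using weight_le_1[of "butlast w"] that by (meson in_set_butlastD not_le subset_iff)
  with True show ?thesis by (auto simp: level_set_def)
next
  case False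
  then have "\<rho> ^ n < 1" using rho_pos rho_less_1 by (simp add: power_less_one_iff)
  with False show ?thesis by (auto simp: level_set_def)
qed

lemma level_set_letters: "w \<in> J n \<Longrightarrow> set w \<subseteq> {1..N}"
  by (simp add: level_set_iff)

lemma level_set_0: "J 0 = {[]}"
  by (simp add: level_set_def)

lemma level_set_strict_prefix:
  assumes "v \<in> J n" "strict_prefix u v" shows "\<rho> ^ n < word_weight r u"
proof -
  have v: "v \<noteq> []" and "prefix u (butlast v)" using assms(2)
    by (auto simp: strict_prefix_def prefix_def butlast_append)
  moreover have "set (butlast v) \<subseteq> {1..N}" using level_set_letters[OF assms(1)]
    by (meson in_set_butlastD subset_iff)
  ultimately have "word_weight r (butlast v) \<le> word_weight r u" by (intro weight_antimono)
  moreover have "\<rho> ^ n < word_weight r (butlast v)" using assms(1) v by (simp add: level_set_iff)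
  ultimately show ?thesis by simp
qed

text \<open>Each level is an antichain for the prefix order: a proper prefix of a member is still too
  heavy to belong to the level.\<close>

lemma level_set_prefix_unique:
  assumes "u \<in> J n" "v \<in> J n" "prefix u x" "prefix v x" shows "u = v"
proof -
  have "prefix u v \<or> prefix v u" using assms(3,4) prefix_same_cases by blast
  moreover have "\<not> strict_prefix u v" "\<not> strict_prefix v u"
    using level_set_strict_prefix assms(1,2) level_set_iff by (metis not_le)+
  ultimately show ?thesis by (auto simp: strict_prefix_def)
qed

text \<open>The word without its last letter has weight greater than \<open>\<rho> ^ n\<close>, and one letter costs a factor
  of at least \<open>\<rho>\<close>. Hence no member of level \<open>n\<close> is light enough for a later level.\<close>

lemma level_set_lower: "w \<in> J n \<Longrightarrow> \<rho> ^ Suc n < word_weight r w"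
proof (cases w rule: rev_cases)
  case Nil
  then show ?thesis using rho_pos rho_less_1 power_Suc_less_one[of \<rho> n] by simp
next
  case (snoc u i)
  assume w: "w \<in> J n"
  then have "\<rho> ^ n < word_weight r u" "i \<in> {1..N}" using snoc by (auto simp: level_set_iff)
  moreover have "0 < \<rho> ^ n" using rho_pos by simp
  ultimately have "\<rho> ^ n * \<rho> < word_weight r u * r i"
    using rho_pos rho_le[of i] by (intro mult_less_le_imp_less) auto
  then show ?thesis using snoc by (simp add: mult.commute)
qed

lemma level_set_disjoint:
  assumes "w \<in> J m" "w \<in> J n" shows "m = n"
proof -
  have "\<not> m < n" if "w \<in> J m" "w \<in> J n" for m n
  proof
    assume "m < n"
    then have "\<rho> ^ n \<le> \<rho> ^ Suc m" using rho_pos rho_less_1 by (intro power_decreasing) auto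
    with that level_set_lower[of w m] show False by (simp add: level_set_iff)
  qed
  with assms show ?thesis by (meson linorder_less_linear)
qed

lemma level_eq: "w \<in> J n \<Longrightarrow> level N r w = n"
  unfolding level_def using level_set_disjoint by (intro the_equality) auto

lemma level_set_subset_X: "J n \<subseteq> X"
  by (auto simp: tree_vertices_def)

lemma tree_vertices_level: "x \<in> X \<Longrightarrow> x \<in> J (level N r x)"
  by (auto simp: tree_vertices_def level_eq)

definition max_ratio :: real where "max_ratio = Max (r ` {1..N})"

lemma max_ratio: "0 < max_ratio" "max_ratio < 1" "i \<in> {1..N} \<Longrightarrow> r i \<le> max_ratio"
proof -
  have "max_ratio \<in> r ` {1..N}" unfolding max_ratio_def using N_pos by (intro Max_in) auto
  then show "0 < max_ratio" "max_ratio < 1" using ratio_pos ratio_less_1 by auto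
qed (simp add: max_ratio_def)

lemma weight_le_max_ratio_power:
  "set w \<subseteq> {1..N} \<Longrightarrow> word_weight r w \<le> max_ratio ^ length w"
proof (induction w)
  case (Cons i w)
  then show ?case
    by (auto intro!: mult_mono simp: max_ratio less_imp_le weight_pos)
qed simp

lemma exists_small_power: "\<exists>k. max_ratio ^ k < \<rho> ^ n"
  using real_arch_pow_inv[of "\<rho> ^ n" max_ratio] rho_pos max_ratio by auto

lemma finite_level_set: "finite (J n)"
proof -
  obtain k where k: "max_ratio ^ k < \<rho> ^ n" using exists_small_power by blast
  have "J n \<subseteq> {w. set w \<subseteq> {1..N} \<and> length w \<le> k}"
  proof safe
    fix w assume w: "w \<in> J n"
    then show "i \<in> {1..N}" if "i \<in> set w" for i using that level_set_letters by blast
    show "length w \<le> k"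
    proof (rule ccontr)
      assume "\<not> length w \<le> k"
      then have "w \<noteq> []" "k \<le> length (butlast w)" by auto
      moreover have "set (butlast w) \<subseteq> {1..N}"
        using level_set_letters[OF w] by (meson in_set_butlastD subset_iff)
      ultimately have "\<rho> ^ n < max_ratio ^ length (butlast w)"
        using w weight_le_max_ratio_power[of "butlast w"] by (auto simp: level_set_iff)
      also have "\<dots> \<le> max_ratio ^ k" using max_ratio \<open>k \<le> length (butlast w)\<close>
        by (intro power_decreasing) auto
      finally show False using k by simp
    qed
  qed
  then show ?thesis using finite_lists_length_le[of "{1..N}" k] finite_subset by blast
qed

text \<open>For an infinite word over \<open>{1..N}\<close> this is its only prefix in level \<open>n\<close>; for other streams the
  minimum may fail to exist and the value is arbitrary.\<close>

definition cut :: "nat \<Rightarrow> nat stream \<Rightarrow> nat list" where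
  "cut n s = stake (LEAST k. word_weight r (stake k s) \<le> \<rho> ^ n) s"

lemma stake_weight_small:
  assumes "sset s \<subseteq> {1..N}" shows "\<exists>k. word_weight r (stake k s) \<le> \<rho> ^ n"
proof -
  obtain k where k: "max_ratio ^ k < \<rho> ^ n" using exists_small_power by blast
  have "set (stake k s) \<subseteq> {1..N}" using assms set_stake_subset[of k s] by blast
  from weight_le_max_ratio_power[OF this] k show ?thesis by (intro exI[of _ k]) simp
qed

lemma cut_in_level_set:
  assumes "sset s \<subseteq> {1..N}" shows "cut n s \<in> J n"
proof -
  define k where "k = (LEAST k. word_weight r (stake k s) \<le> \<rho> ^ n)"
  have "word_weight r (stake k s) \<le> \<rho> ^ n"
    unfolding k_def using stake_weight_small[OF assms] by (rule LeastI_ex)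
  moreover have "\<rho> ^ n < word_weight r (butlast (stake k s))" if "stake k s \<noteq> []"
  proof -
    obtain j where j: "k = Suc j" using \<open>stake k s \<noteq> []\<close> by (cases k) auto
    then have "\<not> word_weight r (stake j s) \<le> \<rho> ^ n"
      using not_less_Least[of j] unfolding k_def by (metis lessI)
    moreover have "butlast (stake k s) = stake j s" by (simp add: j stake_Suc del: stake.simps)
    ultimately show ?thesis by simp
  qed
  moreover have "set (stake k s) \<subseteq> {1..N}" using assms set_stake_subset[of k s] by blast
  ultimately show ?thesis unfolding cut_def k_def[symmetric] by (simp add: level_set_iff)
qed

lemma cut_mono:
  assumes "sset s \<subseteq> {1..N}" "m \<le> n" shows "prefix (cut m s) (cut n s)"
  unfolding cut_def
proof (rule prefix_of_stake, rule Least_le)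
  let ?k = "LEAST k. word_weight r (stake k s) \<le> \<rho> ^ n"
  have "word_weight r (stake ?k s) \<le> \<rho> ^ n"
    using stake_weight_small[OF assms(1)] by (rule LeastI_ex)
  also have "\<dots> \<le> \<rho> ^ m" using rho_pos rho_less_1 assms(2) by (intro power_decreasing) auto
  finally show "word_weight r (stake ?k s) \<le> \<rho> ^ m" .
qed

lemma cut_eq_iff:
  assumes "sset s \<subseteq> {1..N}" "w \<in> J n" shows "cut n s = w \<longleftrightarrow> stake (length w) s = w"
proof
  show "stake (length w) s = w" if "cut n s = w"
    using that by (auto simp: cut_def)
next
  assume w: "stake (length w) s = w"
  define k where "k = (LEAST k. word_weight r (stake k s) \<le> \<rho> ^ n)"
  have "prefix (cut n s) (stake (max k (length w)) s)"
    unfolding cut_def k_def[symmetric] by (intro prefix_of_stake) simp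
  moreover have "prefix w (stake (max k (length w)) s)"
    using prefix_of_stake[of "length w" "max k (length w)" s] w by simp
  ultimately show "cut n s = w"
    using level_set_prefix_unique[OF cut_in_level_set[OF assms(1)] assms(2)] by blast
qed

lemma parent_eq:
  assumes "x \<in> J (Suc n)" "u \<in> J n" "prefix u x" shows "parent N r x = u"
  unfolding parent_def
proof (rule the_equality)
  show "prefix u x \<and> u \<in> J (level N r x - 1)" using assms by (simp add: level_eq)
  show "v = u" if "prefix v x \<and> v \<in> J (level N r x - 1)" for v
    using that level_set_prefix_unique[OF _ assms(2) _ assms(3), of v] by (simp add: level_eq[OF assms(1)])
qed

lemma parent_cut:
  assumes "sset s \<subseteq> {1..N}" shows "parent N r (cut (Suc n) s) = cut n s"
  using parent_eq[OF cut_in_level_set cut_in_level_set cut_mono] assms by simp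

lemma parent_in_level_set:
  assumes "x \<in> J (Suc n)" shows "parent N r x \<in> J n"
proof -
  \<comment> \<open>any address through \<open>x\<close> will do\<close>
  define s where "s = x @- sconst 1"
  have s: "sset s \<subseteq> {1..N}" using level_set_letters[OF assms] N_pos by (auto simp: s_def)
  have "cut (Suc n) s = x" using cut_eq_iff[OF s assms] by (simp add: s_def stake_shift)
  with parent_cut[OF s] cut_in_level_set[OF s] show ?thesis by metis
qed

end

section \<open>Harmonic extension and exit from a finite set\<close>

text \<open>Iterating the averaging operator on \<open>L\<close>, starting from the value 0 there, gives an increasing
  bounded sequence; its limit is harmonic because the averages are finite sums.\<close>

lemma harmonic_extension_exists:
  fixes P :: "'v \<Rightarrow> 'v \<Rightarrow> real" and F :: "'v \<Rightarrow> real"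
  assumes P: "\<And>x y. x \<in> L \<Longrightarrow> y \<in> D \<Longrightarrow> 0 \<le> P x y" "\<And>x. x \<in> L \<Longrightarrow> (\<Sum>y\<in>D. P x y) = 1"
    and F: "\<And>x. 0 \<le> F x" "\<And>x. F x \<le> 1"
  obtains h where "\<And>x. x \<notin> L \<Longrightarrow> h x = F x" "\<And>x. x \<in> L \<Longrightarrow> (\<Sum>y\<in>D. P x y * h y) = h x"
proof -
  define step where "step u = (\<lambda>x. if x \<in> L then \<Sum>y\<in>D. P x y * u y else F x)" for u :: "'v \<Rightarrow> real"
  define u where "u n = (step ^^ n) (\<lambda>x. if x \<in> L then 0 else F x)" for n
  have u_Suc: "u (Suc n) = step (u n)" for n by (simp add: u_def)
  have bounds: "0 \<le> u n x \<and> u n x \<le> 1" for n x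
  proof (induction n arbitrary: x)
    case 0
    then show ?case using F by (simp add: u_def)
  next
    case (Suc n)
    have "(\<Sum>y\<in>D. P x y * u n y) \<le> (\<Sum>y\<in>D. P x y * 1)" if "x \<in> L"
      using Suc P(1)[OF that] by (intro sum_mono mult_left_mono) auto
    then show ?case
      using F Suc P by (auto simp: u_Suc step_def intro!: sum_nonneg)
  qed
  have mono: "u n x \<le> u (Suc n) x" for n x
  proof (induction n arbitrary: x)
    case 0
    have "0 \<le> (\<Sum>y\<in>D. P x y * u 0 y)" if "x \<in> L"
      using bounds[of 0] P(1)[OF that] by (intro sum_nonneg mult_nonneg_nonneg) auto
    then show ?case by (auto simp: u_Suc step_def) (auto simp: u_def)
  next
    case (Suc n)
    then show ?case using P(1) unfolding u_Suc[of "Suc n"] u_Suc[of n]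
      by (auto simp: step_def intro!: sum_mono mult_left_mono)
  qed
  have "\<exists>l. (\<lambda>n. u n x) \<longlonglongrightarrow> l" for x
  proof -
    have "incseq (\<lambda>n. u n x)" using mono by (intro incseq_SucI)
    moreover have "\<forall>n. u n x \<le> 1" using bounds by blast
    ultimately show ?thesis by (rule incseq_convergent) blast
  qed
  then obtain h where h: "\<And>x. (\<lambda>n. u n x) \<longlonglongrightarrow> h x" by metis
  have "h x = F x" if "x \<notin> L" for x
  proof -
    have "u n x = F x" for n using that by (cases n) (auto simp: u_def step_def)
    then show ?thesis using h[of x] by (simp add: LIMSEQ_const_iff)
  qed
  moreover have "(\<Sum>y\<in>D. P x y * h y) = h x" if "x \<in> L" for x
  proof -
    have "(\<lambda>n. \<Sum>y\<in>D. P x y * u n y) \<longlonglongrightarrow> (\<Sum>y\<in>D. P x y * h y)"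
      by (intro tendsto_sum tendsto_mult tendsto_const h)
    moreover have "(\<lambda>n. \<Sum>y\<in>D. P x y * u n y) = (\<lambda>n. u (Suc n) x)" using that by (simp add: u_Suc step_def)
    moreover have "(\<lambda>n. u (Suc n) x) \<longlonglongrightarrow> h x" using h by (rule LIMSEQ_Suc)
    ultimately show ?thesis using LIMSEQ_unique by metis
  qed
  ultimately show ?thesis using that by blast
qed

text \<open>The defining product formula of a chain concerns single paths; summing it over the finitely
  many paths inside \<open>L\<close> gives the Markov property for a walk that has not yet left \<open>L\<close>.\<close>

lemma markov_chain_step_inside:
  fixes Z :: "nat \<Rightarrow> 'w \<Rightarrow> 'v"
  assumes mc: "markov_chain M X P o' Z" and L: "finite L" "L \<subseteq> X" and "z \<in> X"
  shows "measure M {\<omega> \<in> space M. (\<forall>j\<le>k. Z j \<omega> \<in> L) \<and> Z k \<omega> = y \<and> Z (Suc k) \<omega> = z}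
       = measure M {\<omega> \<in> space M. (\<forall>j\<le>k. Z j \<omega> \<in> L) \<and> Z k \<omega> = y} * P y z"
proof -
  interpret prob_space M using mc by (simp add: markov_chain_def)
  have [measurable]: "Z n \<in> measurable M (count_space UNIV)" for n
    using mc measurable_compose[of "Z n" M "count_space X" "\<lambda>x. x" "count_space UNIV"]
    by (simp add: markov_chain_def)
  define W where "W = {w. set w \<subseteq> L \<and> length w = Suc k \<and> w ! k = y}"
  have finW: "finite W"
    by (rule finite_subset[OF _ finite_lists_length_eq[OF L(1), of "Suc k"]]) (auto simp: W_def)
  define A where "A w = {\<omega> \<in> space M. \<forall>j\<le>k. Z j \<omega> = w ! j}" for w
  define B where "B w = {\<omega> \<in> space M. \<forall>j\<le>Suc k. Z j \<omega> = (w @ [z]) ! j}" for w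
  have wX: "w ! j \<in> X" if "w \<in> W" "j \<le> k" for w j
    using that L(2) nth_mem[of j w] by (auto simp: W_def subset_iff)
  have path: "map (\<lambda>j. Z j \<omega>) [0..<Suc k] \<in> W" if "\<forall>j\<le>k. Z j \<omega> \<in> L" "Z k \<omega> = y" for \<omega>
    using that by (auto simp: W_def simp del: upt_Suc)
  have nth_path: "\<forall>j\<le>k. Z j \<omega> = map (\<lambda>j. Z j \<omega>) [0..<Suc k] ! j" for \<omega>
    by (simp del: upt_Suc)
  have nth_snoc: "(\<forall>j\<le>Suc k. Z j \<omega> = (w @ [z]) ! j) \<longleftrightarrow> (\<forall>j\<le>k. Z j \<omega> = w ! j) \<and> Z (Suc k) \<omega> = z"
    if "w \<in> W" for w \<omega>
    using that by (auto simp: W_def nth_append le_Suc_eq)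
  have A: "{\<omega> \<in> space M. (\<forall>j\<le>k. Z j \<omega> \<in> L) \<and> Z k \<omega> = y} = (\<Union>w\<in>W. A w)" (is "?lhs = _")
  proof (intro equalityI subsetI)
    fix \<omega> assume "\<omega> \<in> ?lhs"
    then show "\<omega> \<in> (\<Union>w\<in>W. A w)" using path[of \<omega>] nth_path[of \<omega>] unfolding A_def by blast
  next
    fix \<omega> assume "\<omega> \<in> (\<Union>w\<in>W. A w)"
    then show "\<omega> \<in> ?lhs" by (auto simp: A_def W_def)
  qed
  have B: "{\<omega> \<in> space M. (\<forall>j\<le>k. Z j \<omega> \<in> L) \<and> Z k \<omega> = y \<and> Z (Suc k) \<omega> = z} = (\<Union>w\<in>W. B w)" (is "?lhs = _")
  proof -
    have "?lhs = {\<omega> \<in> space M. (\<forall>j\<le>k. Z j \<omega> \<in> L) \<and> Z k \<omega> = y} \<inter> {\<omega>. Z (Suc k) \<omega> = z}" by auto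
    also have "\<dots> = (\<Union>w\<in>W. B w)" unfolding A by (auto simp: A_def B_def nth_snoc)
    finally show ?thesis .
  qed
  have ext: "w = w'" if "w \<in> W" "w' \<in> W" "\<forall>j\<le>k. w ! j = w' ! j" for w w'
    using that by (auto simp: W_def intro!: nth_equalityI)
  have "disjoint_family_on A W" "disjoint_family_on B W"
    using ext by (auto simp: disjoint_family_on_def A_def B_def nth_snoc)
  moreover have "A w \<in> sets M" "B w \<in> sets M" for w unfolding A_def B_def by measurable
  ultimately have "measure M (\<Union>w\<in>W. A w) = (\<Sum>w\<in>W. measure M (A w))"
      and "measure M (\<Union>w\<in>W. B w) = (\<Sum>w\<in>W. measure M (B w))"
    by (auto intro!: finite_measure_finite_Union[OF finW])
  moreover have "measure M (B w) = measure M (A w) * P y z" if "w \<in> W" for w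
  proof -
    have "measure M (B w) = measure M {\<omega> \<in> space M. \<forall>j\<le>k. Z j \<omega> = (w @ [z]) ! j}
            * P ((w @ [z]) ! k) ((w @ [z]) ! Suc k)"
      unfolding B_def
    proof (rule mc[unfolded markov_chain_def, THEN conjunct2, THEN conjunct2, THEN conjunct2, rule_format])
      show "(w @ [z]) ! j \<in> X" if "j \<le> Suc k" for j
        using that wX[OF \<open>w \<in> W\<close>] \<open>w \<in> W\<close> \<open>z \<in> X\<close> by (auto simp: W_def nth_append le_Suc_eq)
    qed
    moreover have "{\<omega> \<in> space M. \<forall>j\<le>k. Z j \<omega> = (w @ [z]) ! j} = A w"
      using that by (auto simp: A_def W_def nth_append)
    ultimately show ?thesis using that by (simp add: W_def nth_append)
  qed
  ultimately show ?thesis unfolding A B by (simp add: sum_distrib_right)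
qed

text \<open>Optional stopping: until the walk leaves \<open>L\<close>, a harmonic function changes by increments of mean
  zero, and it is bounded on the finite set \<open>D\<close> that contains \<open>L\<close> and all its neighbours.\<close>

lemma expectation_at_exit:
  fixes Z :: "nat \<Rightarrow> 'w \<Rightarrow> 'v::countable" and h :: "'v \<Rightarrow> real"
  assumes mc: "markov_chain M X P o' Z"
    and D: "finite D" "D \<subseteq> X" and L: "L \<subseteq> D" "o' \<in> L"
    and P: "\<And>x. x \<in> L \<Longrightarrow> (\<Sum>y\<in>D. P x y) = 1"
    and h: "\<And>x. x \<in> L \<Longrightarrow> (\<Sum>y\<in>D. P x y * h y) = h x"
    and exit: "AE \<omega> in M. \<exists>j. Z j \<omega> \<notin> L"
  defines "\<tau> \<equiv> \<lambda>\<omega>. LEAST j. Z j \<omega> \<notin> L"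
  shows "(\<integral>\<omega>. h (Z (\<tau> \<omega>) \<omega>) \<partial>M) = h o'"
proof -
  interpret prob_space M using mc by (simp add: markov_chain_def)
  have Z[measurable]: "Z n \<in> measurable M (count_space UNIV)" for n
    using mc measurable_compose[of "Z n" M "count_space X" "\<lambda>x. x" "count_space UNIV"]
    by (simp add: markov_chain_def)
  have finL: "finite L" "L \<subseteq> X" using D L finite_subset by auto
  define I where "I k = {\<omega> \<in> space M. \<forall>j\<le>k. Z j \<omega> \<in> L}" for k
  have I[measurable]: "I k \<in> sets M" for k unfolding I_def by measurable
  define Q where "Q k y = {\<omega> \<in> space M. (\<forall>j\<le>k. Z j \<omega> \<in> L) \<and> Z k \<omega> = y}" for k y
  have Q[measurable]: "Q k y \<in> sets M" for k y unfolding Q_def by measurable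
  have QU: "I k = (\<Union>y\<in>L. Q k y)" for k by (auto simp: I_def Q_def)
  have Qdisj: "disjoint_family_on (Q k) L" for k by (auto simp: disjoint_family_on_def Q_def)
  define R where "R k y z = {\<omega> \<in> space M. (\<forall>j\<le>k. Z j \<omega> \<in> L) \<and> Z k \<omega> = y \<and> Z (Suc k) \<omega> = z}" for k y z
  have R[measurable]: "R k y z \<in> sets M" for k y z unfolding R_def by measurable
  have markov: "measure M (R k y z) = measure M (Q k y) * P y z" if "z \<in> X" for k y z
    unfolding R_def Q_def using markov_chain_step_inside[OF mc finL that] .
  \<comment> \<open>the transition probabilities into \<open>D\<close> exhaust the total mass, so a step from \<open>L\<close> ends in \<open>D\<close>\<close>
  have step: "AE \<omega> in M. \<omega> \<in> I k \<longrightarrow> Z (Suc k) \<omega> \<in> D" for k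
  proof -
    have "measure M (\<Union>z\<in>D. R k y z) = measure M (Q k y)" if "y \<in> L" for y
    proof -
      have "measure M (\<Union>z\<in>D. R k y z) = (\<Sum>z\<in>D. measure M (R k y z))"
        using D R by (intro finite_measure_finite_Union) (auto simp: disjoint_family_on_def R_def)
      also have "\<dots> = (\<Sum>z\<in>D. measure M (Q k y) * P y z)"
        using D markov by (intro sum.cong) auto
      also have "\<dots> = measure M (Q k y)" using P[OF that] by (simp add: sum_distrib_left[symmetric])
      finally show ?thesis .
    qed
    then have "measure M (Q k y - (\<Union>z\<in>D. R k y z)) = 0" if "y \<in> L" for y
      using that D by (subst finite_measure_Diff) (auto simp: R_def Q_def)
    then have "AE \<omega> in M. \<omega> \<notin> Q k y - (\<Union>z\<in>D. R k y z)" if "y \<in> L" for y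
      using that D by (intro AE_not_in) (auto simp: null_sets_def emeasure_eq_measure)
    then have "AE \<omega> in M. \<forall>y\<in>L. \<omega> \<notin> Q k y - (\<Union>z\<in>D. R k y z)"
      using finL by (intro AE_finite_allI) auto
    then show ?thesis by (rule AE_mp) (auto simp: QU R_def Q_def intro!: AE_I2)
  qed
  have start: "AE \<omega> in M. Z 0 \<omega> = o'" using mc by (simp add: markov_chain_def)
  \<comment> \<open>the stopped walk\<close>
  define W where "W k \<omega> = Z (min k (\<tau> \<omega>)) \<omega>" for k \<omega>
  have tau[measurable]: "\<tau> \<in> measurable M (count_space UNIV)" unfolding \<tau>_def by measurable
  have Wmeas[measurable]: "W k \<in> measurable M (count_space UNIV)" for k
    unfolding W_def by (rule measurable_compose_countable[where g="\<lambda>\<omega>. min k (\<tau> \<omega>)"]) measurable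
  have tau_gt: "k < \<tau> \<omega> \<longleftrightarrow> \<omega> \<in> I k" if "\<omega> \<in> space M" "\<exists>j. Z j \<omega> \<notin> L" for k \<omega>
  proof
    assume "k < \<tau> \<omega>"
    then have "Z j \<omega> \<in> L" if "j \<le> k" for j using not_less_Least[of j "\<lambda>j. Z j \<omega> \<notin> L"] that
      by (auto simp: \<tau>_def)
    then show "\<omega> \<in> I k" using that by (simp add: I_def)
  next
    assume "\<omega> \<in> I k"
    moreover have "Z (\<tau> \<omega>) \<omega> \<notin> L" unfolding \<tau>_def using that(2) by (rule LeastI_ex)
    ultimately show "k < \<tau> \<omega>" unfolding I_def by (metis (no_types, lifting) mem_Collect_eq not_less)
  qed
  have good: "AE \<omega> in M. (\<exists>j. Z j \<omega> \<notin> L) \<and> Z 0 \<omega> = o' \<and> (\<forall>k. \<omega> \<in> I k \<longrightarrow> Z (Suc k) \<omega> \<in> D)"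
    using exit start step by (simp add: AE_all_countable)
  have W_step: "W (Suc k) \<omega> = (if \<omega> \<in> I k then Z (Suc k) \<omega> else W k \<omega>) \<and> (\<omega> \<in> I k \<longrightarrow> W k \<omega> = Z k \<omega>)"
    if "\<omega> \<in> space M" "\<exists>j. Z j \<omega> \<notin> L" for k \<omega>
  proof (cases "k < \<tau> \<omega>")
    case True
    then show ?thesis using tau_gt[OF that, of k] by (simp add: W_def min_def)
  next
    case False
    then have "min (Suc k) (\<tau> \<omega>) = \<tau> \<omega>" "min k (\<tau> \<omega>) = \<tau> \<omega>" by auto
    then show ?thesis using False tau_gt[OF that, of k] by (simp add: W_def)
  qed
  have W_D: "AE \<omega> in M. \<forall>k. W k \<omega> \<in> D"
    using good
  proof (rule AE_mp, intro AE_I2 impI)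
    fix \<omega> assume \<omega>: "\<omega> \<in> space M" "(\<exists>j. Z j \<omega> \<notin> L) \<and> Z 0 \<omega> = o' \<and> (\<forall>k. \<omega> \<in> I k \<longrightarrow> Z (Suc k) \<omega> \<in> D)"
    have "W k \<omega> \<in> D" for k
    proof (induction k)
      case 0
      then show ?case using \<omega> L by (auto simp: W_def)
    next
      case (Suc k)
      then show ?case using W_step[of \<omega> k] \<omega> by auto
    qed
    then show "\<forall>k. W k \<omega> \<in> D" by blast
  qed
  define C where "C = (\<Sum>x\<in>D. \<bar>h x\<bar>)"
  have C: "\<bar>h x\<bar> \<le> C" if "x \<in> D" for x unfolding C_def using D that by (intro member_le_sum) auto
  have bound: "AE \<omega> in M. \<bar>h (W k \<omega>)\<bar> \<le> C" for k using W_D by eventually_elim (simp add: C)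
  have int: "integrable M (\<lambda>\<omega>. h (W k \<omega>))" for k
    by (rule integrable_const_bound[of _ C]) (use bound in \<open>auto\<close>)
  \<comment> \<open>each step of the stopped walk is written as a sum over the transitions \<open>y \<rightarrow> z\<close> that it may make\<close>
  have mean: "(\<integral>\<omega>. h (W k \<omega>) \<partial>M) = h o'" for k
  proof (induction k)
    case 0
    have "(\<integral>\<omega>. h (W 0 \<omega>) \<partial>M) = (\<integral>\<omega>. h o' \<partial>M)"
      using start by (intro integral_cong_AE) (auto simp: W_def)
    then show ?case by (simp add: prob_space)
  next
    case (Suc k)
    have "(\<integral>\<omega>. h (W (Suc k) \<omega>) - h (W k \<omega>) \<partial>M)
        = (\<integral>\<omega>. (\<Sum>y\<in>L. \<Sum>z\<in>D. (h z - h y) * indicator (R k y z) \<omega>) \<partial>M)"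
    proof (rule integral_cong_AE)
      show "AE \<omega> in M. h (W (Suc k) \<omega>) - h (W k \<omega>) = (\<Sum>y\<in>L. \<Sum>z\<in>D. (h z - h y) * indicator (R k y z) \<omega>)"
        using good
      proof (rule AE_mp, intro AE_I2 impI)
        fix \<omega> assume \<omega>: "\<omega> \<in> space M" "(\<exists>j. Z j \<omega> \<notin> L) \<and> Z 0 \<omega> = o' \<and> (\<forall>k. \<omega> \<in> I k \<longrightarrow> Z (Suc k) \<omega> \<in> D)"
        show "h (W (Suc k) \<omega>) - h (W k \<omega>) = (\<Sum>y\<in>L. \<Sum>z\<in>D. (h z - h y) * indicator (R k y z) \<omega>)"
        proof (cases "\<omega> \<in> I k")
          case True
          have ind: "(h z - h y) * indicator (R k y z) \<omega>
              = (if y = Z k \<omega> then if z = Z (Suc k) \<omega> then h z - h y else 0 else 0)" for y z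
            using True by (auto simp: R_def I_def indicator_def)
          have "(\<Sum>y\<in>L. \<Sum>z\<in>D. (h z - h y) * indicator (R k y z) \<omega>)
              = (\<Sum>y\<in>L. if y = Z k \<omega> then \<Sum>z\<in>D. if z = Z (Suc k) \<omega> then h z - h y else 0 else 0)"
            unfolding ind by (intro sum.cong) auto
          also have "\<dots> = h (Z (Suc k) \<omega>) - h (Z k \<omega>)"
          proof -
            have "Z k \<omega> \<in> L" "Z (Suc k) \<omega> \<in> D" using True \<omega> by (auto simp: I_def)
            then show ?thesis using D finL by simp
          qed
          finally show ?thesis using W_step[of \<omega> k] \<omega> True by simp
        next
          case False
          then have "indicator (R k y z) \<omega> = (0::real)" for y z by (auto simp: R_def I_def indicator_def)
          then show ?thesis using W_step[of \<omega> k] \<omega> False by simp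
        qed
      qed
    qed auto
    also have "\<dots> = (\<Sum>y\<in>L. \<Sum>z\<in>D. (h z - h y) * measure M (R k y z))"
    proof -
      have "integrable M (\<lambda>\<omega>. (h z - h y) * indicator (R k y z) \<omega>)" for y z
        by (intro integrable_mult_right integrable_real_indicator R) (simp add: emeasure_eq_measure)
      then show ?thesis by (simp add: Bochner_Integration.integral_sum integrable_sum)
    qed
    also have "\<dots> = (\<Sum>y\<in>L. measure M (Q k y) * ((\<Sum>z\<in>D. P y z * h z) - h y * (\<Sum>z\<in>D. P y z)))"
    proof (intro sum.cong refl)
      fix y assume "y \<in> L"
      have "(\<Sum>z\<in>D. (h z - h y) * measure M (R k y z)) = (\<Sum>z\<in>D. measure M (Q k y) * (P y z * h z - h y * P y z))"
        using D markov by (intro sum.cong) (auto simp: algebra_simps)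
      then show "(\<Sum>z\<in>D. (h z - h y) * measure M (R k y z))
          = measure M (Q k y) * ((\<Sum>z\<in>D. P y z * h z) - h y * (\<Sum>z\<in>D. P y z))"
        by (simp add: sum_distrib_left sum_subtractf right_diff_distrib)
    qed
    also have "\<dots> = 0" using P h by simp
    finally show ?case using Suc int by (simp add: Bochner_Integration.integral_diff)
  qed
  have "(\<lambda>k. \<integral>\<omega>. h (W k \<omega>) \<partial>M) \<longlonglongrightarrow> (\<integral>\<omega>. h (Z (\<tau> \<omega>) \<omega>) \<partial>M)"
  proof (rule integral_dominated_convergence[where w="\<lambda>_. C"])
    show "(\<lambda>\<omega>. h (Z (\<tau> \<omega>) \<omega>)) \<in> borel_measurable M"
      by (rule measurable_compose[OF _ borel_measurable_count_space])
        (rule measurable_compose_countable[where g=\<tau>]; measurable)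
    show "AE \<omega> in M. (\<lambda>k. h (W k \<omega>)) \<longlonglongrightarrow> h (Z (\<tau> \<omega>) \<omega>)"
    proof (rule AE_I2)
      fix \<omega>
      have "eventually (\<lambda>k. h (W k \<omega>) = h (Z (\<tau> \<omega>) \<omega>)) sequentially"
        using eventually_ge_at_top[of "\<tau> \<omega>"] by eventually_elim (simp add: W_def min_def)
      then show "(\<lambda>k. h (W k \<omega>)) \<longlonglongrightarrow> h (Z (\<tau> \<omega>) \<omega>)" by (rule tendsto_eventually)
    qed
  qed (use bound in auto)
  then show "(\<integral>\<omega>. h (Z (\<tau> \<omega>) \<omega>) \<partial>M) = h o'" by (simp add: mean LIMSEQ_const_iff)
qed

section \<open>The Bernoulli measure on addresses\<close>

locale weighted_ratios = contraction_ratios +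
  fixes p :: "nat \<Rightarrow> real"
  assumes p_pos: "\<And>i. i \<in> {1..N} \<Longrightarrow> 0 < p i"
    and p_sum: "(\<Sum>i=1..N. p i) = 1"
begin

definition letter_pmf :: "nat pmf" where
  "letter_pmf = embed_pmf (\<lambda>i. if i \<in> {1..N} then p i else 0)"

lemma pmf_letter: "pmf letter_pmf i = (if i \<in> {1..N} then p i else 0)"
  unfolding letter_pmf_def
proof (rule pmf_embed_pmf)
  show "0 \<le> (if i \<in> {1..N} then p i else 0)" for i using p_pos by (simp add: less_imp_le)
  have "(\<integral>\<^sup>+ i. ennreal (if i \<in> {1..N} then p i else 0) \<partial>count_space UNIV)
      = (\<Sum>i\<in>{1..N}. ennreal (if i \<in> {1..N} then p i else 0))"
    by (intro nn_integral_count_space') auto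
  also have "\<dots> = ennreal (\<Sum>i\<in>{1..N}. p i)"
    using p_pos by (subst sum_ennreal[symmetric]) (auto simp: less_imp_le)
  finally show "(\<integral>\<^sup>+ i. ennreal (if i \<in> {1..N} then p i else 0) \<partial>count_space UNIV) = 1"
    using p_sum by simp
qed

lemma set_pmf_letter: "set_pmf letter_pmf = {1..N}"
proof (rule set_eqI)
  show "i \<in> set_pmf letter_pmf \<longleftrightarrow> i \<in> {1..N}" for i
    using p_pos[of i] by (auto simp: set_pmf_iff pmf_letter)
qed

definition addresses :: "nat stream measure" where
  "addresses = stream_space (measure_pmf letter_pmf)"

sublocale addresses: prob_space addresses
  unfolding addresses_def by (rule prob_space.prob_space_stream_space[OF prob_space_measure_pmf])

lemma sets_addresses [measurable_cong]: "sets addresses = sets (stream_space (count_space UNIV))"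
  unfolding addresses_def by (rule sets_stream_space_cong) simp

lemma space_addresses [simp]: "space addresses = UNIV"
  by (simp add: addresses_def space_stream_space)

lemma AE_addresses: "AE s in addresses. sset s \<subseteq> {1..N}"
proof -
  have "AE s in addresses. stream_all (\<lambda>i. i \<in> {1..N}) s" unfolding addresses_def
    by (rule prob_space.AE_stream_all[OF prob_space_measure_pmf]) (auto simp: AE_measure_pmf_iff set_pmf_letter)
  then show ?thesis by eventually_elim (auto simp: stream_all_def sset_range)
qed

lemma stake_measurable [measurable]: "stake k \<in> measurable addresses (count_space UNIV)"
  by measurable

lemma cut_measurable [measurable]: "cut n \<in> measurable addresses (count_space UNIV)"
  unfolding cut_def
  by (rule measurable_compose_countable[where f="\<lambda>k s. stake k s"]) measurable

lemma p_weight_pos: "set w \<subseteq> {1..N} \<Longrightarrow> 0 < word_weight p w"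
  by (induction w) (auto intro!: mult_pos_pos p_pos)

lemma prob_cylinder:
  "set w \<subseteq> {1..N} \<Longrightarrow> measure addresses {s. stake (length w) s = w} = word_weight p w"
proof -
  have "emeasure addresses {s. stake (length w) s = w} = ennreal (word_weight p w)" if "set w \<subseteq> {1..N}"
    using that
  proof (induction w)
    case Nil
    then show ?case using addresses.emeasure_space_1 by simp
  next
    case (Cons i w)
    let ?C = "\<lambda>w. {s. stake (length w) s = w}"
    have C: "?C w \<in> sets addresses" for w :: "nat list"
    proof -
      have "?C w = stake (length w) -` {w} \<inter> space addresses" by auto
      also have "\<dots> \<in> sets addresses" by (rule measurable_sets[OF stake_measurable]) simp
      finally show ?thesis .
    qed
    have "emeasure addresses (?C (i # w))
        = (\<integral>\<^sup>+ t. emeasure addresses {s. t ## s \<in> ?C (i # w)} \<partial>measure_pmf letter_pmf)"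
      using prob_space.emeasure_stream_space[OF prob_space_measure_pmf, of "?C (i # w)" letter_pmf] C[of "i # w"]
      by (simp add: addresses_def space_stream_space)
    also have "\<dots> = (\<integral>\<^sup>+ t. emeasure addresses (?C w) * indicator {i} t \<partial>measure_pmf letter_pmf)"
      by (intro nn_integral_cong) (auto simp: indicator_def)
    also have "\<dots> = ennreal (word_weight p w) * ennreal (p i)"
      using Cons by (simp add: nn_integral_cmult emeasure_pmf_single pmf_letter)
    also have "\<dots> = ennreal (word_weight p (i # w))"
      using Cons.prems p_pos[of i] p_weight_pos[of w] by (simp add: ennreal_mult' mult.commute)
    finally show ?case .
  qed
  moreover assume "set w \<subseteq> {1..N}"
  ultimately show ?thesis using p_weight_pos[of w] by (simp add: measure_def)
qed

text \<open>Both prefixes at which an address is read off, the one of a given level and the one of a given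
  length, range over a finite antichain \<open>A\<close>; then a value \<open>w\<close> is attained exactly on the cylinder of
  \<open>w\<close>.\<close>

lemma integral_discrete:
  fixes g :: "nat list \<Rightarrow> real"
  assumes [measurable]: "Y \<in> measurable addresses (count_space UNIV)"
    and "finite A" "AE s in addresses. Y s \<in> A"
    and A: "\<And>w. w \<in> A \<Longrightarrow> set w \<subseteq> {1..N}"
    and Y: "\<And>s w. sset s \<subseteq> {1..N} \<Longrightarrow> w \<in> A \<Longrightarrow> Y s = w \<longleftrightarrow> stake (length w) s = w"
  shows "(\<integral>s. g (Y s) \<partial>addresses) = (\<Sum>w\<in>A. word_weight p w * g w)"
proof -
  have [measurable]: "{s. Y s = w} \<in> sets addresses" "{s. stake (length w) s = w} \<in> sets addresses" for w
    using measurable_sets[OF assms(1), of "{w}"] measurable_sets[OF stake_measurable, of "{w}" "length w"]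
    by (auto simp: vimage_def)
  have "(\<integral>s. g (Y s) \<partial>addresses) = (\<integral>s. (\<Sum>w\<in>A. g w * indicator {s. Y s = w} s) \<partial>addresses)"
  proof (rule integral_cong_AE)
    show "AE s in addresses. g (Y s) = (\<Sum>w\<in>A. g w * indicator {s. Y s = w} s)"
      using assms(3)
    proof eventually_elim
      fix s assume "Y s \<in> A"
      then show "g (Y s) = (\<Sum>w\<in>A. g w * indicator {s. Y s = w} s)"
        using assms(2) by (simp add: indicator_def if_distrib[of "\<lambda>t. _ * t"] cong: if_cong)
    qed
  qed measurable
  also have "\<dots> = (\<Sum>w\<in>A. g w * measure addresses {s. Y s = w})"
    by (subst Bochner_Integration.integral_sum)
      (auto intro!: integrable_mult_right integrable_real_indicator simp: addresses.emeasure_eq_measure)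
  also have "\<dots> = (\<Sum>w\<in>A. word_weight p w * g w)"
  proof (intro sum.cong refl)
    fix w assume w: "w \<in> A"
    have "measure addresses {s. Y s = w} = measure addresses {s. stake (length w) s = w}"
    proof (rule addresses.finite_measure_eq_AE)
      show "AE s in addresses. s \<in> {s. Y s = w} \<longleftrightarrow> s \<in> {s. stake (length w) s = w}"
        using AE_addresses by eventually_elim (simp add: Y w)
    qed measurable
    then show "g w * measure addresses {s. Y s = w} = word_weight p w * g w"
      using prob_cylinder[OF A[OF w]] by simp
  qed
  finally show ?thesis .
qed

lemma integral_cut: "(\<integral>s. g (cut n s) \<partial>addresses) = (\<Sum>x\<in>J n. word_weight p x * g x)"
proof (rule integral_discrete)
  show "AE s in addresses. cut n s \<in> J n" using AE_addresses by eventually_elim (rule cut_in_level_set)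
  show "set w \<subseteq> {1..N}" if "w \<in> J n" for w using that by (rule level_set_letters)
qed (simp_all only: finite_level_set cut_eq_iff cut_measurable)

lemma integral_stake:
  "(\<integral>s. g (stake k s) \<partial>addresses) = (\<Sum>w | set w \<subseteq> {1..N} \<and> length w = k. word_weight p w * g w)"
proof (rule integral_discrete)
  show "AE s in addresses. stake k s \<in> {w. set w \<subseteq> {1..N} \<and> length w = k}"
    using AE_addresses by eventually_elim (use set_stake_subset in fastforce)
qed (auto simp: finite_lists_length_eq)

text \<open>Both sides are the mean of \<open>g (cut n s)\<close>, because the parent of \<open>cut (Suc n) s\<close> is
  \<open>cut n s\<close>: the weights of the children of a vertex add up to its own weight.\<close>

lemma sum_over_parents:
  "(\<Sum>x\<in>J (Suc n). word_weight p x * g (parent N r x)) = (\<Sum>x\<in>J n. word_weight p x * g x)"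
proof -
  have "(\<integral>s. g (parent N r (cut (Suc n) s)) \<partial>addresses) = (\<integral>s. g (cut n s) \<partial>addresses)"
    using AE_addresses by (intro integral_cong_AE) (auto elim!: eventually_mono simp: parent_cut)
  then show ?thesis using integral_cut[of "\<lambda>x. g (parent N r x)"] integral_cut[of g] by simp
qed

end

section \<open>Harmonic functions and the flow between levels\<close>

locale quasi_natural_walk = weighted_ratios N r p
  for N :: nat and r p :: "nat \<Rightarrow> real" +
  fixes S :: "nat \<Rightarrow> 'a::euclidean_space \<Rightarrow> 'a" and K :: "'a set" and \<gamma> lam :: real
    and c :: "nat list \<Rightarrow> nat list \<Rightarrow> real"
  assumes lam_pos: "0 < lam" and conductance: "qnrw_conductance N S r K \<gamma> p lam c"
begin

abbreviation E :: "(nat list \<times> nat list) set" where "E \<equiv> tree_edges N S r K \<gamma>"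

lemma c_sym: "x \<in> X \<Longrightarrow> y \<in> X \<Longrightarrow> c x y = c y x"
  and c_nonneg: "x \<in> X \<Longrightarrow> y \<in> X \<Longrightarrow> 0 \<le> c x y"
  and c_zero: "x \<in> X \<Longrightarrow> y \<in> X \<Longrightarrow> (x, y) \<notin> E \<Longrightarrow> c x y = 0"
  and c_parent: "x \<in> J (Suc m) \<Longrightarrow> c x (parent N r x) = word_weight p x / lam ^ Suc m"
  using conductance unfolding qnrw_conductance_def by (auto simp del: power_Suc)

lemma edge_levels:
  assumes "(x, y) \<in> E" "x \<in> J m" "y \<in> J n"
  shows "m = n \<or> m = Suc n \<and> y = parent N r x \<or> n = Suc m \<and> x = parent N r y"
proof -
  have par: "j = Suc i" if "v \<in> J j" "j \<ge> 1" "u = parent N r v" "u \<in> J i" for u v i j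
    using that parent_in_level_set[of v "j - 1"] level_set_disjoint[of u i "j - 1"] by auto
  show ?thesis using assms par[of y n x m] par[of x m y n]
    by (auto simp: tree_edges_def vertical_edges_def horizontal_edges_def level_eq)
qed

lemma parent_edge:
  assumes "x \<in> J (Suc m)" shows "(parent N r x, x) \<in> E"
  using assms parent_in_level_set[OF assms] level_eq[OF assms] level_set_subset_X
  by (auto simp: tree_edges_def vertical_edges_def)

lemma c_up:
  assumes "y \<in> J m" "z \<in> J (Suc m)"
  shows "c y z = (if y = parent N r z then word_weight p z / lam ^ Suc m else 0)"
proof (cases "y = parent N r z")
  case True
  then show ?thesis using c_parent[OF assms(2)] c_sym[of y z] assms level_set_subset_X by auto
next
  case False
  then have "(y, z) \<notin> E" using edge_levels[OF _ assms] by auto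
  then show ?thesis using False c_zero assms level_set_subset_X by auto
qed

lemma c_far:
  assumes "y \<in> J m" "z \<in> J n" "m \<noteq> n" "m \<noteq> Suc n" "n \<noteq> Suc m" shows "c y z = 0"
proof -
  have "(y, z) \<notin> E" using edge_levels[OF _ assms(1,2)] assms by auto
  then show ?thesis using c_zero assms level_set_subset_X by auto
qed

definition below :: "nat \<Rightarrow> nat list set" where "below n = (\<Union>m<n. J m)"

lemma below_Suc: "below (Suc n) = below n \<union> J n"
  by (auto simp: below_def lessThan_Suc)

lemma finite_below: "finite (below n)"
  by (simp add: below_def finite_level_set)

lemma below_subset_X: "below n \<subseteq> X"
  using level_set_subset_X by (auto simp: below_def)

lemma below_disjoint: "m \<ge> n \<Longrightarrow> x \<in> J m \<Longrightarrow> x \<notin> below n"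
  unfolding below_def using level_set_disjoint by (metis UN_E lessThan_iff not_less)

text \<open>The total current, for the potential \<open>h\<close>, through the edges that join level \<open>m\<close> to level
  \<open>Suc m\<close>.\<close>

definition flow :: "(nat list \<Rightarrow> real) \<Rightarrow> nat \<Rightarrow> real" where
  "flow h m = (\<Sum>y\<in>J m. \<Sum>z\<in>J (Suc m). c y z * (h z - h y))"

definition level_mean :: "(nat list \<Rightarrow> real) \<Rightarrow> nat \<Rightarrow> real" where
  "level_mean h m = (\<Sum>x\<in>J m. word_weight p x * h x)"

text \<open>On level \<open>m\<close>, a vertex of level \<open>Suc m\<close> is joined to its parent only, by a conductance proportional to its
  weight; grouping the vertices by their parents gives the two level means.\<close>

lemma flow_eq: "flow h m = (level_mean h (Suc m) - level_mean h m) / lam ^ Suc m"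
proof -
  have "flow h m = (\<Sum>z\<in>J (Suc m). \<Sum>y\<in>J m.
      (if y = parent N r z then word_weight p z / lam ^ Suc m * (h z - h y) else 0))"
    unfolding flow_def by (subst sum.swap) (intro sum.cong refl, simp add: c_up)
  also have "\<dots> = (\<Sum>z\<in>J (Suc m). word_weight p z / lam ^ Suc m * (h z - h (parent N r z)))"
    using parent_in_level_set finite_level_set by (intro sum.cong) auto
  also have "\<dots> = (\<Sum>z\<in>J (Suc m). word_weight p z * h z - word_weight p z * h (parent N r z)) / lam ^ Suc m"
    by (simp add: sum_divide_distrib field_simps)
  also have "\<dots> = (level_mean h (Suc m) - level_mean h m) / lam ^ Suc m"
    by (simp only: sum_subtractf sum_over_parents level_mean_def)
  finally show ?thesis .
qed

text \<open>Harmonicity summed over level \<open>m\<close>: the terms inside the level cancel in pairs by symmetry of \<open>c\<close>,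
  and what leaves the level downwards is what enters it from above. The root level has nothing
  above it.\<close>

lemma flow_conservation:
  assumes "m < n" and harm: "\<And>x. x \<in> J m \<Longrightarrow> (\<Sum>y\<in>below (Suc n). c x y * (h y - h x)) = 0"
  shows "flow h m = (if m = 0 then 0 else flow h (m - 1))"
proof -
  let ?s = "\<lambda>k. \<Sum>x\<in>J m. \<Sum>y\<in>J k. c x y * (h y - h x)"
  have "0 = (\<Sum>x\<in>J m. \<Sum>y\<in>below (Suc n). c x y * (h y - h x))" using harm by simp
  also have "\<dots> = (\<Sum>x\<in>J m. \<Sum>k<Suc n. \<Sum>y\<in>J k. c x y * (h y - h x))"
    unfolding below_def
    by (intro sum.cong refl sum.UNION_disjoint) (use finite_level_set level_set_disjoint in \<open>blast+\<close>)
  also have "\<dots> = (\<Sum>k<Suc n. ?s k)" by (rule sum.swap)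
  also have "\<dots> = (\<Sum>k\<in>{m, Suc m} \<union> (if m = 0 then {} else {m - 1}). ?s k)"
  proof (rule sum.mono_neutral_right)
    show "\<forall>k\<in>{..<Suc n} - ({m, Suc m} \<union> (if m = 0 then {} else {m - 1})). ?s k = 0"
    proof
      fix k assume "k \<in> {..<Suc n} - ({m, Suc m} \<union> (if m = 0 then {} else {m - 1}))"
      then have "m \<noteq> k" "m \<noteq> Suc k" "k \<noteq> Suc m" by (auto split: if_splits)
      then show "?s k = 0" by (intro sum.neutral ballI) (simp add: c_far)
    qed
  qed (use assms(1) in auto)
  also have "\<dots> = ?s m + flow h m + (if m = 0 then 0 else ?s (m - 1))"
    by (cases m) (auto simp: flow_def)
  also have "?s m = 0"
  proof -
    have "?s m = (\<Sum>y\<in>J m. \<Sum>x\<in>J m. c x y * (h y - h x))" by (rule sum.swap)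
    also have "\<dots> = (\<Sum>y\<in>J m. \<Sum>x\<in>J m. - (c y x * (h x - h y)))"
      using c_sym level_set_subset_X by (intro sum.cong refl) (auto simp: algebra_simps subset_iff)
    also have "\<dots> = - ?s m" by (simp add: sum_negf)
    finally show ?thesis by simp
  qed
  also have "(if m = 0 then 0 else ?s (m - 1)) = - (if m = 0 then 0 else flow h (m - 1))"
  proof (cases m)
    case (Suc k)
    have "?s k = (\<Sum>y\<in>J k. \<Sum>x\<in>J m. c x y * (h y - h x))" by (rule sum.swap)
    also have "\<dots> = (\<Sum>y\<in>J k. \<Sum>x\<in>J m. - (c y x * (h x - h y)))"
      using c_sym level_set_subset_X by (intro sum.cong refl) (auto simp: algebra_simps subset_iff)
    finally show ?thesis by (simp add: sum_negf flow_def Suc)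
  qed simp
  finally show ?thesis by simp
qed

text \<open>The conserved flow starts with 0 at the root.\<close>

lemma level_mean_constant:
  assumes harm: "\<And>x. x \<in> below n \<Longrightarrow> (\<Sum>y\<in>below (Suc n). c x y * (h y - h x)) = 0"
  shows "level_mean h n = h []"
proof -
  have flow0: "m < n \<Longrightarrow> flow h m = 0" for m
  proof (induction m)
    case 0
    then show ?case using flow_conservation[of 0 n h] harm by (auto simp: below_def)
  next
    case (Suc m)
    then show ?case using flow_conservation[of "Suc m" n h] harm by (auto simp: below_def)
  qed
  have "m \<le> n \<Longrightarrow> level_mean h m = level_mean h 0" for m
  proof (induction m)
    case (Suc m)
    then show ?case using flow0[of m] lam_pos by (simp add: flow_eq)
  qed simp
  then show ?thesis by (simp add: level_mean_def level_set_0)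
qed

text \<open>All neighbours of a vertex in \<open>below n\<close> lie in \<open>below (Suc n)\<close>, so the infinite sum in the
  definition of \<open>transition\<close> is a finite one; it is positive because the vertex has a child.\<close>

lemma transition_below:
  assumes "x \<in> below n"
  shows "transition X c x y = c x y / (\<Sum>z\<in>below (Suc n). c x z)"
    and "0 < (\<Sum>z\<in>below (Suc n). c x z)"
proof -
  obtain m where m: "m < n" "x \<in> J m" using assms by (auto simp: below_def)
  have "c x z = 0" if "z \<in> X - below (Suc n)" for z
  proof -
    have "\<exists>k. z \<in> J k" using that by (auto simp: tree_vertices_def)
    then obtain k where k: "z \<in> J k" by blast
    then have "\<not> k < Suc n" using that by (auto simp: below_def)
    then show ?thesis using c_far[OF m(2) k] m by auto
  qed
  then have "(\<Sum>\<^sub>\<infinity>z\<in>X. c x z) = (\<Sum>\<^sub>\<infinity>z\<in>below (Suc n). c x z)"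
    using below_subset_X by (intro infsum_cong_neutral) auto
  then show "transition X c x y = c x y / (\<Sum>z\<in>below (Suc n). c x z)"
    by (simp add: transition_def infsum_finite finite_below)
  have xX: "x \<in> X" using assms below_subset_X by auto
  \<comment> \<open>a child of \<open>x\<close> is found on any address through \<open>x\<close>\<close>
  define s where "s = x @- sconst 1"
  have s: "sset s \<subseteq> {1..N}" using level_set_letters[OF m(2)] N_pos by (auto simp: s_def)
  have "cut m s = x" using cut_eq_iff[OF s m(2)] by (simp add: s_def stake_shift)
  then have par: "x = parent N r (cut (Suc m) s)" using parent_cut[OF s] by metis
  have z: "cut (Suc m) s \<in> J (Suc m)" by (rule cut_in_level_set[OF s])
  have "0 < c x (cut (Suc m) s)" using c_up[OF m(2) z] par p_weight_pos[OF level_set_letters[OF z]] lam_pos by simp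
  moreover have "cut (Suc m) s \<in> below (Suc n)" using z m by (auto simp: below_def)
  ultimately show "0 < (\<Sum>z\<in>below (Suc n). c x z)"
    using c_nonneg[OF xX] below_subset_X by (intro sum_pos2[OF finite_below]) auto
qed

text \<open>The first vertex outside \<open>below n\<close> is distributed on level \<open>n\<close> like the prefix of a random
  address: apply optional stopping to the harmonic extension of \<open>F\<close>, whose value at the root is its
  mean on level \<open>n\<close>.\<close>

lemma exit_law:
  assumes mc: "markov_chain M X (transition X c) [] Z"
    and exit: "AE \<omega> in M. \<exists>j. Z j \<omega> \<notin> below n" and n: "n > 0"
    and F: "\<And>x. 0 \<le> F x" "\<And>x. F x \<le> 1"
  shows "(\<integral>\<omega>. F (Z (LEAST j. Z j \<omega> \<notin> below n) \<omega>) \<partial>M) = (\<Sum>x\<in>J n. word_weight p x * F x)"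
proof -
  let ?P = "transition X c" and ?D = "below (Suc n)"
  have P_nonneg: "0 \<le> ?P x y" if "x \<in> below n" "y \<in> ?D" for x y
    using that transition_below(2)[OF that(1)] c_nonneg[of x y] below_subset_X
    by (auto simp: transition_below(1)[OF that(1)] subset_iff)
  have P_sum: "(\<Sum>y\<in>?D. ?P x y) = 1" if "x \<in> below n" for x
    using transition_below(2)[OF that] by (simp add: transition_below(1)[OF that] sum_divide_distrib[symmetric])
  obtain h where h_out: "\<And>x. x \<notin> below n \<Longrightarrow> h x = F x"
    and h: "\<And>x. x \<in> below n \<Longrightarrow> (\<Sum>y\<in>?D. ?P x y * h y) = h x"
    by (rule harmonic_extension_exists[where P="?P" and L="below n" and D="?D" and F=F])
      (use P_nonneg P_sum F in auto)
  have "(\<Sum>y\<in>?D. c x y * (h y - h x)) = 0" if "x \<in> below n" for x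
  proof -
    let ?m = "\<Sum>y\<in>?D. c x y"
    have "(\<Sum>y\<in>?D. ?P x y * h y) = (\<Sum>y\<in>?D. c x y * h y) / ?m"
      by (simp add: transition_below(1)[OF that] sum_divide_distrib)
    then have "(\<Sum>y\<in>?D. c x y * h y) = h x * ?m"
      using h[OF that] transition_below(2)[OF that] by (simp add: field_simps)
    then show ?thesis by (simp add: right_diff_distrib sum_subtractf sum_distrib_left mult.commute)
  qed
  then have "h [] = level_mean h n" using level_mean_constant by simp
  also have "\<dots> = (\<Sum>x\<in>J n. word_weight p x * F x)"
    unfolding level_mean_def using below_disjoint h_out by (intro sum.cong) auto
  finally have h_root: "h [] = (\<Sum>x\<in>J n. word_weight p x * F x)" .
  have root: "[] \<in> below n" using n level_set_0 by (auto simp: below_def)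
  have "(\<integral>\<omega>. h (Z (LEAST j. Z j \<omega> \<notin> below n) \<omega>) \<partial>M) = h []"
    by (rule expectation_at_exit[OF mc finite_below below_subset_X _ root P_sum h exit]) (auto simp: below_Suc)
  moreover have "(\<integral>\<omega>. h (Z (LEAST j. Z j \<omega> \<notin> below n) \<omega>) \<partial>M) = (\<integral>\<omega>. F (Z (LEAST j. Z j \<omega> \<notin> below n) \<omega>) \<partial>M)"
  proof (rule integral_cong_AE)
    show "AE \<omega> in M. h (Z (LEAST j. Z j \<omega> \<notin> below n) \<omega>) = F (Z (LEAST j. Z j \<omega> \<notin> below n) \<omega>)"
      using exit by eventually_elim (rule h_out, rule LeastI_ex)
    have [measurable]: "Z n \<in> measurable M (count_space UNIV)" for n
      using mc measurable_compose[of "Z n" M "count_space X" "\<lambda>x. x" "count_space UNIV"]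
      by (simp add: markov_chain_def)
    have [measurable]: "(\<lambda>\<omega>. Z (LEAST j. Z j \<omega> \<notin> below n) \<omega>) \<in> measurable M (count_space UNIV)"
      by (rule measurable_compose_countable[where g="\<lambda>\<omega>. LEAST j. Z j \<omega> \<notin> below n"]) measurable
    show "(\<lambda>\<omega>. h (Z (LEAST j. Z j \<omega> \<notin> below n) \<omega>)) \<in> borel_measurable M"
      "(\<lambda>\<omega>. F (Z (LEAST j. Z j \<omega> \<notin> below n) \<omega>)) \<in> borel_measurable M" by measurable
  qed
  ultimately show ?thesis using h_root by simp
qed

end

section \<open>Self-similar measures as limits over words\<close>

text \<open>Distances to a closed set give Lipschitz functions that decrease to its indicator.\<close>

lemma measure_eqI_lipschitz:
  fixes M M' :: "'a::metric_space measure"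
  assumes "prob_space M" "prob_space M'" and sets: "sets M = sets borel" "sets M' = sets borel"
    and eq: "\<And>f C. C-lipschitz_on UNIV f \<Longrightarrow> (\<And>x. 0 \<le> f x \<and> f x \<le> (1::real)) \<Longrightarrow>
      (\<integral>x. f x \<partial>M) = (\<integral>x. f x \<partial>M')"
  shows "M = M'"
proof (rule measure_eqI_generator_eq[where E="Collect closed" and \<Omega>=UNIV and A="\<lambda>_. UNIV"])
  interpret M: prob_space M by fact
  interpret M': prob_space M' by fact
  show "emeasure M X = emeasure M' X" if "X \<in> Collect closed" for X
  proof (cases "X = {}")
    case False
    have X: "closed X" using that by simp
    define f where "f n x = max 0 (1 - real n * infdist x X)" for n x
    have f: "0 \<le> f n x \<and> f n x \<le> 1" for n x by (simp add: f_def infdist_nonneg)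
    have lip: "(real n)-lipschitz_on UNIV (f n)" for n
    proof (rule lipschitz_onI)
      fix x y :: 'a
      have "\<bar>infdist x X - infdist y X\<bar> \<le> dist x y"
        using infdist_triangle_abs[of x X y] by simp
      then have "real n * \<bar>infdist x X - infdist y X\<bar> \<le> real n * dist x y"
        by (intro mult_left_mono) auto
      moreover have "real n * \<bar>infdist x X - infdist y X\<bar> = \<bar>real n * infdist x X - real n * infdist y X\<bar>"
        by (simp add: abs_mult right_diff_distrib[symmetric])
      moreover have "dist (f n x) (f n y) \<le> \<bar>real n * infdist x X - real n * infdist y X\<bar>"
        unfolding f_def dist_real_def by linarith
      ultimately show "dist (f n x) (f n y) \<le> real n * dist x y" by linarith
    qed simp
    have f_lim: "(\<lambda>n. f n x) \<longlonglongrightarrow> indicator X x" for x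
    proof (cases "x \<in> X")
      case True
      then show ?thesis by (simp add: f_def)
    next
      case notin: False
      then have pos: "0 < infdist x X" using X False by (simp add: infdist_pos_not_in_closed)
      obtain n0 where n0: "1 < real n0 * infdist x X" using reals_Archimedean3[OF pos] by blast
      have "eventually (\<lambda>n. f n x = 0) sequentially"
        using eventually_ge_at_top[of n0]
      proof eventually_elim
        fix n assume "n0 \<le> n"
        then have "real n0 * infdist x X \<le> real n * infdist x X" by (intro mult_right_mono) (auto simp: infdist_nonneg)
        then show "f n x = 0" using n0 by (simp add: f_def)
      qed
      then show ?thesis using notin by (simp add: tendsto_eventually)
    qed
    have cont: "continuous_on UNIV (f n)" for n
      using lip by (rule lipschitz_on_continuous_on)
    have meas: "measure Q X = lim (\<lambda>n. \<integral>x. f n x \<partial>Q)" if Q: "prob_space Q" "sets Q = sets borel" for Q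
    proof -
      interpret Q: prob_space Q by fact
      have [measurable]: "f n \<in> borel_measurable Q" for n
        using borel_measurable_continuous_onI[OF cont] Q(2) measurable_cong_sets by blast
      have [measurable]: "X \<in> sets Q" using X Q(2) by auto
      have "(\<lambda>n. \<integral>x. f n x \<partial>Q) \<longlonglongrightarrow> (\<integral>x. indicator X x \<partial>Q)"
        by (rule integral_dominated_convergence[where w="\<lambda>_. 1"]) (use f f_lim in auto)
      moreover have "(\<integral>x. indicator X x \<partial>Q) = measure Q X"
        using \<open>X \<in> sets Q\<close> sets.sets_into_space by (simp add: Int_absorb1)
      ultimately show ?thesis by (simp add: limI)
    qed
    have "measure M X = measure M' X"
      using meas[OF assms(1) sets(1)] meas[OF assms(2) sets(2)] eq[OF lip f] by simp
    then show ?thesis by (simp add: M.emeasure_eq_measure M'.emeasure_eq_measure)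
  qed simp
  show "sets M = sigma_sets UNIV (Collect closed)" "sets M' = sigma_sets UNIV (Collect closed)"
    using sets by (simp_all add: borel_eq_closed)
  show "emeasure M UNIV \<noteq> \<infinity>" using M.emeasure_finite[of UNIV] by simp
qed (auto simp: Int_stable_def)

lemma contractive_similitude_measurable:
  fixes f :: "'a::euclidean_space \<Rightarrow> 'a"
  assumes "contractive_similitude f \<rho>" shows "f \<in> borel_measurable borel"
proof (rule borel_measurable_continuous_onI)
  have "\<rho>-lipschitz_on UNIV f" using assms
    by (intro lipschitz_onI) (auto simp: contractive_similitude_def)
  then show "continuous_on UNIV f" by (rule lipschitz_on_continuous_on)
qed

text \<open>The invariance of \<open>\<mu>\<close>, stated for sets, extends to functions by the usual induction over
  nonnegative measurable functions.\<close>

lemma self_similar_measure_nn_integral: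
  fixes S :: "nat \<Rightarrow> 'a::euclidean_space \<Rightarrow> 'a"
  assumes \<mu>: "self_similar_measure N S p \<mu>" and p: "\<And>i. i \<in> {1..N} \<Longrightarrow> 0 \<le> p i"
    and S: "\<And>i. i \<in> {1..N} \<Longrightarrow> S i \<in> borel_measurable borel"
    and f: "f \<in> borel_measurable borel"
  shows "(\<integral>\<^sup>+ x. f x \<partial>\<mu>) = (\<Sum>i=1..N. ennreal (p i) * (\<integral>\<^sup>+ x. f (S i x) \<partial>\<mu>))"
proof -
  have sets[measurable_cong]: "sets \<mu> = sets borel" and "prob_space \<mu>"
    using \<mu> by (auto simp: self_similar_measure_def)
  interpret prob_space \<mu> by fact
  have space: "space \<mu> = UNIV" using sets_eq_imp_space_eq[OF sets] by simp
  have S\<mu>: "S i \<in> measurable \<mu> borel" if "i \<in> {1..N}" for i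
    using S[OF that] sets measurable_cong_sets by blast
  note uS = measurable_compose[OF S\<mu>]
  show ?thesis using f
  proof (induction rule: borel_measurable_induct)
    case (cong f g)
    then show ?case by simp
  next
    case (set A)
    then have A[measurable]: "A \<in> sets borel" by simp
    have "(\<integral>\<^sup>+ x. indicator A x \<partial>\<mu>) = ennreal (measure \<mu> A)"
      using A sets by (simp add: emeasure_eq_measure)
    also have "\<dots> = ennreal (\<Sum>i=1..N. p i * measure \<mu> (S i -` A))"
      using \<mu> A by (simp add: self_similar_measure_def)
    also have "\<dots> = (\<Sum>i=1..N. ennreal (p i) * ennreal (measure \<mu> (S i -` A)))"
      using p by (subst sum_ennreal[symmetric]) (auto simp: ennreal_mult intro!: mult_nonneg_nonneg)
    also have "\<dots> = (\<Sum>i=1..N. ennreal (p i) * (\<integral>\<^sup>+ x. indicator A (S i x) \<partial>\<mu>))"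
    proof (intro sum.cong refl)
      fix i assume i: "i \<in> {1..N}"
      have "S i -` A \<in> sets \<mu>" using measurable_sets[OF S\<mu>[OF i] A] space by simp
      moreover have "(\<lambda>x. indicator A (S i x) :: ennreal) = indicator (S i -` A)" by (auto simp: indicator_def)
      ultimately show "ennreal (p i) * ennreal (measure \<mu> (S i -` A)) = ennreal (p i) * (\<integral>\<^sup>+ x. indicator A (S i x) \<partial>\<mu>)"
        by (simp add: emeasure_eq_measure)
    qed
    finally show ?case .
  next
    case (mult u a)
    have "(\<integral>\<^sup>+ x. a * u (S i x) \<partial>\<mu>) = a * (\<integral>\<^sup>+ x. u (S i x) \<partial>\<mu>)" if "i \<in> {1..N}" for i
      using mult that by (intro nn_integral_cmult uS)
    then have "(\<Sum>i=1..N. ennreal (p i) * (\<integral>\<^sup>+ x. a * u (S i x) \<partial>\<mu>))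
        = (\<Sum>i=1..N. a * (ennreal (p i) * (\<integral>\<^sup>+ x. u (S i x) \<partial>\<mu>)))"
      by (intro sum.cong refl) (simp add: mult.left_commute)
    then show ?case using mult by (simp add: nn_integral_cmult sum_distrib_left)
  next
    case (add u v)
    have "(\<integral>\<^sup>+ x. v (S i x) + u (S i x) \<partial>\<mu>) = (\<integral>\<^sup>+ x. v (S i x) \<partial>\<mu>) + (\<integral>\<^sup>+ x. u (S i x) \<partial>\<mu>)" if "i \<in> {1..N}" for i
      using add that by (intro nn_integral_add uS)
    then have "(\<Sum>i=1..N. ennreal (p i) * (\<integral>\<^sup>+ x. v (S i x) + u (S i x) \<partial>\<mu>))
        = (\<Sum>i=1..N. ennreal (p i) * (\<integral>\<^sup>+ x. v (S i x) \<partial>\<mu>) + ennreal (p i) * (\<integral>\<^sup>+ x. u (S i x) \<partial>\<mu>))"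
      by (intro sum.cong refl) (simp add: distrib_left)
    then show ?case using add by (simp add: nn_integral_add sum.distrib)
  next
    case (seq U)
    have "U n \<in> borel_measurable \<mu>" for n using seq(1) sets measurable_cong_sets by blast
    then have "(\<integral>\<^sup>+ x. (SUP n. U n) x \<partial>\<mu>) = (SUP n. \<integral>\<^sup>+ x. U n x \<partial>\<mu>)"
      unfolding SUP_apply using seq by (intro nn_integral_monotone_convergence_SUP)
    also have "\<dots> = (SUP n. \<Sum>i=1..N. ennreal (p i) * (\<integral>\<^sup>+ x. U n (S i x) \<partial>\<mu>))"
      by (simp only: seq)
    also have "\<dots> = (\<Sum>i=1..N. SUP n. ennreal (p i) * (\<integral>\<^sup>+ x. U n (S i x) \<partial>\<mu>))"
    proof (rule ennreal_SUP_sum)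
      show "incseq (\<lambda>n. ennreal (p i) * (\<integral>\<^sup>+ x. U n (S i x) \<partial>\<mu>))" for i
        using seq by (auto simp: incseq_def le_fun_def intro!: mult_left_mono nn_integral_mono)
    qed
    also have "\<dots> = (\<Sum>i=1..N. ennreal (p i) * (\<integral>\<^sup>+ x. (SUP n. U n) (S i x) \<partial>\<mu>))"
    proof (intro sum.cong refl)
      fix i assume i: "i \<in> {1..N}"
      have "(\<integral>\<^sup>+ x. (SUP n. U n) (S i x) \<partial>\<mu>) = (SUP n. \<integral>\<^sup>+ x. U n (S i x) \<partial>\<mu>)"
        unfolding SUP_apply
      proof (rule nn_integral_monotone_convergence_SUP)
        show "incseq (\<lambda>n x. U n (S i x))" using seq by (auto simp: incseq_def le_fun_def)
        show "(\<lambda>x. U n (S i x)) \<in> borel_measurable \<mu>" for n using seq i by (intro uS)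
      qed
      then show "(SUP n. ennreal (p i) * (\<integral>\<^sup>+ x. U n (S i x) \<partial>\<mu>)) = ennreal (p i) * (\<integral>\<^sup>+ x. (SUP n. U n) (S i x) \<partial>\<mu>)"
        by (simp add: SUP_mult_left_ennreal)
    qed
    finally show ?case .
  qed
qed

lemma words_Suc:
  "{w. set w \<subseteq> A \<and> length w = Suc k} = (\<lambda>(i, w). i # w) ` (A \<times> {w. set w \<subseteq> A \<and> length w = k})"
  by (auto simp: length_Suc_conv image_iff)

locale self_similar_walk = quasi_natural_walk N r p S K \<gamma> lam c
  for N :: nat and r p :: "nat \<Rightarrow> real" and S :: "nat \<Rightarrow> 'a::euclidean_space \<Rightarrow> 'a"
    and K \<gamma> lam c +
  assumes similitude: "\<And>i. i \<in> {1..N} \<Longrightarrow> contractive_similitude (S i) (r i)"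
    and attractor: "self_similar_set N S K"
begin

lemma dist_word_map:
  "set w \<subseteq> {1..N} \<Longrightarrow> dist (word_map S w x) (word_map S w y) = word_weight r w * dist x y"
  using similitude by (induction w) (auto simp: contractive_similitude_def)

lemma word_map_attractor: "set w \<subseteq> {1..N} \<Longrightarrow> x \<in> K \<Longrightarrow> word_map S w x \<in> K"
proof (induction w)
  case (Cons i w)
  then have "S i (word_map S w x) \<in> (\<Union>i\<in>{1..N}. S i ` K)" by auto
  moreover have "(\<Union>i\<in>{1..N}. S i ` K) = K" using attractor by (metis self_similar_set_def)
  ultimately have "S i (word_map S w x) \<in> K" by metis
  then show ?case by simp
qed simp

lemma S_measurable: "i \<in> {1..N} \<Longrightarrow> S i \<in> borel_measurable borel"
  using similitude contractive_similitude_measurable by blast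

lemma word_map_measurable: "set w \<subseteq> {1..N} \<Longrightarrow> word_map S w \<in> borel_measurable borel"
  by (induction w) (auto simp: comp_def id_def intro: measurable_compose[OF _ S_measurable])

lemma self_similar_measure_integral_words:
  assumes \<mu>: "self_similar_measure N S p \<mu>"
    and f: "f \<in> borel_measurable borel" "\<And>x. 0 \<le> f x \<and> f x \<le> (1::real)"
  shows "(\<integral>x. f x \<partial>\<mu>) = (\<Sum>w | set w \<subseteq> {1..N} \<and> length w = k. word_weight p w * (\<integral>x. f (word_map S w x) \<partial>\<mu>))"
  using f
proof (induction k arbitrary: f)
  case 0
  have "{w. set w \<subseteq> {1..N} \<and> length w = 0} = {[]}" by auto
  then show ?case by simp
next
  case (Suc k)
  have sets[measurable_cong]: "sets \<mu> = sets borel" and "prob_space \<mu>"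
    using \<mu> by (auto simp: self_similar_measure_def)
  interpret prob_space \<mu> by fact
  note [measurable] = Suc.prems(1)
  have fS[measurable]: "(\<lambda>x. f (S i x)) \<in> borel_measurable borel" if "i \<in> {1..N}" for i
    using measurable_compose[OF S_measurable[OF that] Suc.prems(1)] .
  have int: "ennreal (\<integral>x. g x \<partial>\<mu>) = (\<integral>\<^sup>+ x. g x \<partial>\<mu>)"
    if "g \<in> borel_measurable borel" "\<And>x. 0 \<le> g x \<and> g x \<le> (1::real)" for g
    using that by (intro nn_integral_eq_integral[symmetric] integrable_const_bound[where B=1]) auto
  have "ennreal (\<integral>x. f x \<partial>\<mu>) = (\<Sum>i=1..N. ennreal (p i) * (\<integral>\<^sup>+ x. f (S i x) \<partial>\<mu>))"
    using Suc.prems p_pos S_measurable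
    by (subst int, simp, simp, subst self_similar_measure_nn_integral[OF \<mu>]) (auto simp: less_imp_le)
  also have "\<dots> = (\<Sum>i=1..N. ennreal (p i * (\<integral>x. f (S i x) \<partial>\<mu>)))"
    using Suc.prems p_pos fS
    by (intro sum.cong refl) (simp add: int[symmetric] ennreal_mult less_imp_le)
  also have "\<dots> = ennreal (\<Sum>i=1..N. p i * (\<integral>x. f (S i x) \<partial>\<mu>))"
    using Suc.prems p_pos by (intro sum_ennreal mult_nonneg_nonneg) (auto simp: less_imp_le)
  finally have "(\<integral>x. f x \<partial>\<mu>) = (\<Sum>i=1..N. p i * (\<integral>x. f (S i x) \<partial>\<mu>))"
    using Suc.prems p_pos by (subst (asm) ennreal_inj) (auto simp: less_imp_le intro!: sum_nonneg mult_nonneg_nonneg)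
  also have "\<dots> = (\<Sum>i=1..N. p i * (\<Sum>w | set w \<subseteq> {1..N} \<and> length w = k.
      word_weight p w * (\<integral>x. f (S i (word_map S w x)) \<partial>\<mu>)))"
  proof (intro sum.cong refl)
    fix i assume "i \<in> {1..N}"
    then show "p i * (\<integral>x. f (S i x) \<partial>\<mu>) = p i * (\<Sum>w | set w \<subseteq> {1..N} \<and> length w = k.
      word_weight p w * (\<integral>x. f (S i (word_map S w x)) \<partial>\<mu>))"
      using Suc.IH[OF fS] Suc.prems(2) by simp
  qed
  also have "\<dots> = (\<Sum>(i, w)\<in>{1..N} \<times> {w. set w \<subseteq> {1..N} \<and> length w = k}.
      word_weight p (i # w) * (\<integral>x. f (word_map S (i # w) x) \<partial>\<mu>))"
    by (simp add: sum.cartesian_product[symmetric] sum_distrib_left mult.assoc)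
  also have "\<dots> = (\<Sum>w | set w \<subseteq> {1..N} \<and> length w = Suc k. word_weight p w * (\<integral>x. f (word_map S w x) \<partial>\<mu>))"
    unfolding words_Suc by (subst sum.reindex) (auto simp: inj_on_def case_prod_unfold)
  finally show ?case .
qed

text \<open>By invariance \<open>\<mu>\<close> is the mixture of its images under the words of length \<open>k\<close>; replacing each
  image by the point mass at the image of \<open>\<xi>\<close> changes the integral of \<open>f\<close> little, since long words
  contract strongly. The error at \<open>x\<close> is at most \<open>b k x\<close>, which tends to 0 for every \<open>x\<close> and is
  dominated by 1 because \<open>f\<close> takes its values in \<open>[0, 1]\<close>.\<close>

lemma integral_words_tendsto:
  assumes \<mu>: "self_similar_measure N S p \<mu>"
    and lip: "C-lipschitz_on UNIV f" and f: "\<And>x. 0 \<le> f x \<and> f x \<le> (1::real)"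
  shows "(\<lambda>k. \<integral>s. f (word_map S (stake k s) \<xi>) \<partial>addresses) \<longlonglongrightarrow> (\<integral>x. f x \<partial>\<mu>)"
proof -
  have sets[measurable_cong]: "sets \<mu> = sets borel" and "prob_space \<mu>"
    using \<mu> by (auto simp: self_similar_measure_def)
  interpret prob_space \<mu> by fact
  have fm[measurable]: "f \<in> borel_measurable borel"
    using lip by (intro borel_measurable_continuous_onI lipschitz_on_continuous_on)
  have C: "0 \<le> C" using lip by (rule lipschitz_on_nonneg)
  define b where "b k x = min 1 (C * max_ratio ^ k * dist x \<xi>)" for k and x :: 'a
  have [measurable]: "b k \<in> borel_measurable borel" for k unfolding b_def by measurable
  have b: "0 \<le> b k x" "b k x \<le> 1" for k x using C max_ratio(1) by (auto simp: b_def)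
  have int_b: "integrable \<mu> (b k)" for k using b by (intro integrable_const_bound[where B=1]) auto
  have diff: "\<bar>f (word_map S w x) - f (word_map S w \<xi>)\<bar> \<le> b k x"
    if "set w \<subseteq> {1..N}" "length w = k" for w k x
  proof -
    have "dist (f (word_map S w x)) (f (word_map S w \<xi>)) \<le> C * (word_weight r w * dist x \<xi>)"
      using lipschitz_onD[OF lip, of "word_map S w x" "word_map S w \<xi>"] dist_word_map[OF that(1)] by simp
    also have "\<dots> \<le> C * (max_ratio ^ k * dist x \<xi>)"
      using weight_le_max_ratio_power[OF that(1)] that(2) C by (intro mult_left_mono mult_right_mono) auto
    finally have "\<bar>f (word_map S w x) - f (word_map S w \<xi>)\<bar> \<le> C * max_ratio ^ k * dist x \<xi>"
      by (simp add: dist_real_def mult.assoc)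
    moreover have "\<bar>f (word_map S w x) - f (word_map S w \<xi>)\<bar> \<le> 1"
      using f[of "word_map S w x"] f[of "word_map S w \<xi>"] by linarith
    ultimately show ?thesis by (simp add: b_def)
  qed
  have "\<bar>(\<integral>s. f (word_map S (stake k s) \<xi>) \<partial>addresses) - (\<integral>x. f x \<partial>\<mu>)\<bar> \<le> (\<integral>x. b k x \<partial>\<mu>)" for k
  proof -
    let ?W = "{w. set w \<subseteq> {1..N} \<and> length w = k}"
    have p_sum_W: "(\<Sum>w\<in>?W. word_weight p w) = 1"
      using integral_stake[of "\<lambda>_. 1" k] addresses.prob_space by simp
    have int_f: "integrable \<mu> (\<lambda>x. f (word_map S w x))" if "w \<in> ?W" for w
      using f measurable_compose[OF word_map_measurable[of w] fm] that
      by (intro integrable_const_bound[where B=1]) auto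
    have "(\<integral>s. f (word_map S (stake k s) \<xi>) \<partial>addresses) - (\<integral>x. f x \<partial>\<mu>)
        = (\<Sum>w\<in>?W. word_weight p w * (f (word_map S w \<xi>) - (\<integral>x. f (word_map S w x) \<partial>\<mu>)))"
      unfolding integral_stake[of "\<lambda>w. f (word_map S w \<xi>)"] self_similar_measure_integral_words[OF \<mu> fm f, of k]
      by (simp add: sum_subtractf right_diff_distrib)
    also have "\<bar>\<dots>\<bar> \<le> (\<Sum>w\<in>?W. word_weight p w * (\<integral>x. b k x \<partial>\<mu>))"
    proof (rule order_trans[OF sum_abs], rule sum_mono)
      fix w assume w: "w \<in> ?W"
      have "f (word_map S w \<xi>) - (\<integral>x. f (word_map S w x) \<partial>\<mu>) = (\<integral>x. f (word_map S w \<xi>) - f (word_map S w x) \<partial>\<mu>)"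
        using int_f[OF w] by (simp add: prob_space)
      also have "\<bar>\<dots>\<bar> \<le> (\<integral>x. \<bar>f (word_map S w \<xi>) - f (word_map S w x)\<bar> \<partial>\<mu>)"
        by (rule integral_abs_bound)
      also have "\<dots> \<le> (\<integral>x. b k x \<partial>\<mu>)"
        using diff[of w k] w int_f[OF w] int_b by (intro integral_mono) (auto simp: abs_minus_commute)
      finally show "\<bar>word_weight p w * (f (word_map S w \<xi>) - (\<integral>x. f (word_map S w x) \<partial>\<mu>))\<bar>
          \<le> word_weight p w * (\<integral>x. b k x \<partial>\<mu>)"
        using p_weight_pos[of w] w by (simp add: abs_mult)
    qed
    also have "\<dots> = (\<integral>x. b k x \<partial>\<mu>)" unfolding sum_distrib_right[symmetric] p_sum_W by simp
    finally show ?thesis .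
  qed
  note bound = this
  have "(\<lambda>k. \<integral>x. b k x \<partial>\<mu>) \<longlonglongrightarrow> (\<integral>x. 0 \<partial>\<mu>)"
  proof (rule integral_dominated_convergence[where w="\<lambda>_. 1"])
    show "AE x in \<mu>. (\<lambda>k. b k x) \<longlonglongrightarrow> 0"
    proof (rule AE_I2)
      fix x
      have "(\<lambda>k. max_ratio ^ k) \<longlonglongrightarrow> 0" using max_ratio by (intro LIMSEQ_realpow_zero) auto
      then have "(\<lambda>k. min 1 (C * max_ratio ^ k * dist x \<xi>)) \<longlonglongrightarrow> min 1 (C * 0 * dist x \<xi>)"
        by (intro tendsto_min tendsto_mult tendsto_const)
      then show "(\<lambda>k. b k x) \<longlonglongrightarrow> 0" by (simp add: b_def)
    qed
  qed (use b in auto)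
  then have "(\<lambda>k. \<integral>x. b k x \<partial>\<mu>) \<longlonglongrightarrow> 0" by simp
  moreover have "\<forall>\<^sub>F k in sequentially. norm ((\<integral>s. f (word_map S (stake k s) \<xi>) \<partial>addresses) - (\<integral>x. f x \<partial>\<mu>))
      \<le> (\<integral>x. b k x \<partial>\<mu>)"
    unfolding real_norm_def by (intro always_eventually allI bound)
  ultimately have "(\<lambda>k. (\<integral>s. f (word_map S (stake k s) \<xi>) \<partial>addresses) - (\<integral>x. f x \<partial>\<mu>)) \<longlonglongrightarrow> 0"
    by (rule Lim_null_comparison[rotated])
  then show ?thesis by (rule LIM_zero_cancel)
qed

end

section \<open>Addresses as geodesic rays\<close>

context quasi_natural_walk
begin

lemma edges_in_X: "(x, y) \<in> E \<Longrightarrow> x \<in> X \<and> y \<in> X"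
  by (auto simp: tree_edges_def vertical_edges_def horizontal_edges_def)

lemma path_level_bound:
  "(x, y) \<in> E ^^ k \<Longrightarrow> x \<in> J m \<Longrightarrow> y \<in> J n \<Longrightarrow> n \<le> m + k"
proof (induction k arbitrary: y n)
  case 0
  then show ?case using level_set_disjoint[of x m n] by simp
next
  case (Suc k)
  then obtain z where z: "(x, z) \<in> E ^^ k" "(z, y) \<in> E" by auto
  then have "z \<in> J (level N r z)" using edges_in_X tree_vertices_level by blast
  then show ?case using Suc.IH[OF z(1) Suc.prems(2)] edge_levels[OF z(2) _ Suc.prems(3)] by fastforce
qed

text \<open>An edge changes the level by at most one, so descending by one level at each step is
  shortest possible.\<close>

lemma geodesic_ray_cut:
  assumes s: "sset s \<subseteq> {1..N}" shows "geodesic_ray E [] (\<lambda>n. cut n s)"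
  unfolding geodesic_ray_def
proof (intro conjI allI impI)
  show "cut 0 s = []" using cut_in_level_set[OF s, of 0] by (simp add: level_set_0)
  show edge: "(cut n s, cut (Suc n) s) \<in> E" for n
    using parent_edge[OF cut_in_level_set[OF s, of "Suc n"]] parent_cut[OF s] by simp
  have path: "(cut m s, cut (m + k) s) \<in> E ^^ k" for m k
  proof (induction k)
    case (Suc k)
    then show ?case using edge[of "m + k"] by auto
  qed simp
  show "graph_dist E (cut m s) (cut n s) = n - m" if "m \<le> n" for m n
    unfolding graph_dist_def
  proof (rule Least_equality)
    show "(cut m s, cut n s) \<in> E ^^ (n - m)" using path[of m "n - m"] that by simp
    show "n - m \<le> k" if "(cut m s, cut n s) \<in> E ^^ k" for k
      using path_level_bound[OF that cut_in_level_set[OF s] cut_in_level_set[OF s]] by simp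
  qed
qed

end

context self_similar_walk
begin

text \<open>From the length of \<open>cut n s\<close> on, the points in question stay in the copy of \<open>K\<close> that belongs to
  \<open>cut n s\<close>; it contains \<open>x\<close> and its diameter is at most \<open>\<rho> ^ n * diameter K\<close>.\<close>

lemma word_map_stake_tendsto:
  assumes s: "sset s \<subseteq> {1..N}" and \<xi>: "\<xi> \<in> K" and x: "x \<in> (\<Inter>n. word_map S (cut n s) ` K)"
  shows "(\<lambda>k. word_map S (stake k s) \<xi>) \<longlonglongrightarrow> x"
proof -
  have "bounded K" using attractor by (simp add: self_similar_set_def compact_imp_bounded)
  have dist_le: "dist (word_map S (stake k s) \<xi>) x \<le> \<rho> ^ n * diameter K" if "length (cut n s) \<le> k" for n k
  proof -
    let ?w = "cut n s"
    have "?w = stake (length ?w) s" by (simp add: cut_def)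
    then have "prefix ?w (stake k s)" using prefix_of_stake[OF that, of s] by simp
    then obtain v where v: "stake k s = ?w @ v" by (auto simp: prefix_def)
    have w: "?w \<in> J n" using cut_in_level_set[OF s] .
    have "set v \<subseteq> {1..N}" using v set_stake_subset[of k s] s by auto
    then have vK: "word_map S v \<xi> \<in> K" using word_map_attractor \<xi> by blast
    obtain y where y: "y \<in> K" "x = word_map S ?w y" using x by blast
    have "dist (word_map S (stake k s) \<xi>) x = word_weight r ?w * dist (word_map S v \<xi>) y"
      using dist_word_map[OF level_set_letters[OF w]] by (simp add: v y word_map_append)
    also have "\<dots> \<le> \<rho> ^ n * diameter K"
      using w diameter_bounded_bound[OF \<open>bounded K\<close> vK y(1)] rho_pos
      by (intro mult_mono) (auto simp: level_set_iff)
    finally show ?thesis .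
  qed
  show ?thesis
  proof (rule metric_LIMSEQ_I)
    fix e :: real assume e: "0 < e"
    have "(\<lambda>n. \<rho> ^ n * diameter K) \<longlonglongrightarrow> 0 * diameter K"
      using rho_pos rho_less_1 by (intro tendsto_mult LIMSEQ_realpow_zero tendsto_const) auto
    then have "eventually (\<lambda>n. \<rho> ^ n * diameter K < e) sequentially"
      using e by (simp add: order_tendsto_iff)
    then obtain n where "\<rho> ^ n * diameter K < e" using eventually_happens by force
    then show "\<exists>k0. \<forall>k\<ge>k0. dist (word_map S (stake k s) \<xi>) x < e"
      using dist_le[of n] by (meson le_less_trans)
  qed
qed

end

section \<open>Compactifications and convergence to the boundary\<close>

text \<open>A point of the discrete set \<open>X\<close> is isolated in the compactification: by density, an open set
  that meets the image of \<open>X\<close> in one point only contains no other point.\<close>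

lemma compactification_openin_image:
  assumes "compactification X T \<iota>" shows "openin T (\<iota> ` X)"
proof -
  have H: "Hausdorff_space T" and emb: "embedding_map (discrete_topology X) T \<iota>"
    and dense: "T closure_of (\<iota> ` X) = topspace T"
    using assms by (auto simp: compactification_def)
  have sub: "\<iota> ` X \<subseteq> topspace T" using emb
    by (metis embedding_map_def homeomorphic_imp_surjective_map topspace_discrete_topology
        topspace_subtopology inf_le1)
  have hom: "homeomorphic_map (discrete_topology X) (subtopology T (\<iota> ` X)) \<iota>"
    using emb by (simp add: embedding_map_def)
  have "openin T {\<iota> x}" if x: "x \<in> X" for x
  proof -
    have "openin (discrete_topology X) {x}" using x by simp
    then have "openin (subtopology T (\<iota> ` X)) (\<iota> ` {x})"
      using homeomorphic_imp_open_map[OF hom] unfolding open_map_def by blast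
    then obtain U where U: "openin T U" "{\<iota> x} = U \<inter> \<iota> ` X" by (auto simp: openin_subtopology)
    have "closedin T {\<iota> x}" using H sub x by (simp add: closedin_Hausdorff_singleton image_subset_iff)
    then have "openin T (U - {\<iota> x})" using U(1) by blast
    moreover have "(U - {\<iota> x}) \<inter> \<iota> ` X = {}" using U(2) by blast
    ultimately have "(U - {\<iota> x}) \<inter> T closure_of (\<iota> ` X) = {}"
      by (simp add: openin_Int_closure_of_eq_empty)
    then have "U - {\<iota> x} = {}" using dense openin_subset[OF U(1)] by blast
    then have "U = {\<iota> x}" using U(2) by blast
    then show ?thesis using U(1) by simp
  qed
  then have "openin T (\<Union>x\<in>X. {\<iota> x})" by (intro openin_Union) auto
  then show ?thesis by (simp add: UNION_singleton_eq_range)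
qed

text \<open>Convergence to the boundary forces the walk out of every finite set of vertices, so the
  exit times are almost surely finite; transience enters in this form.\<close>

lemma limitin_boundary_leaves_finite:
  assumes "Hausdorff_space T" "limitin T (\<lambda>n. \<iota> (z n)) \<zeta> sequentially" "\<zeta> \<notin> \<iota> ` X"
    and A: "finite A" "A \<subseteq> X" "\<iota> ` X \<subseteq> topspace T"
  shows "eventually (\<lambda>n. z n \<notin> A) sequentially"
proof -
  have "closedin T (\<iota> ` A)" using assms by (intro closedin_Hausdorff_finite) auto
  then have "openin T (topspace T - \<iota> ` A)" by blast
  moreover have "\<zeta> \<in> topspace T - \<iota> ` A" using assms by (auto simp: limitin_def)
  ultimately have "eventually (\<lambda>n. \<iota> (z n) \<in> topspace T - \<iota> ` A) sequentially"
    using assms(2) by (auto simp: limitin_def)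
  then show ?thesis by eventually_elim auto
qed

text \<open>By Tietze's theorem, because the boundary is closed in a normal space.\<close>

lemma extension_from_boundary:
  assumes comp: "compactification X T \<iota>" and g: "continuous_map (boundary X T \<iota>) euclideanreal g"
    and bounds: "\<And>z. 0 \<le> g z \<and> g z \<le> 1"
  obtains F where "continuous_map T euclideanreal F"
    "\<And>z. z \<in> topspace (boundary X T \<iota>) \<Longrightarrow> F z = g z" "\<And>z. z \<in> topspace T \<Longrightarrow> 0 \<le> F z \<and> F z \<le> 1"
proof -
  have "normal_space T" using comp
    by (intro compact_Hausdorff_or_regular_imp_normal_space) (auto simp: compactification_def)
  moreover have "closedin T (topspace T - \<iota> ` X)"
    using compactification_openin_image[OF comp] by blast
  moreover have "continuous_map (subtopology T (topspace T - \<iota> ` X)) euclideanreal g"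
    using g by (simp add: boundary_def)
  moreover have "g ` (topspace T - \<iota> ` X) \<subseteq> {0..1}" using bounds by auto
  ultimately obtain F where "continuous_map T euclideanreal F"
    "\<And>z. z \<in> topspace T - \<iota> ` X \<Longrightarrow> F z = g z" "F ` topspace T \<subseteq> {0..1}"
    by (rule Tietze_extension_closed_real_interval) auto
  then show ?thesis by (intro that[of F]) (auto simp: boundary_def image_subset_iff)
qed

lemma continuous_map_measurable_borel_of_topology:
  fixes g :: "'t \<Rightarrow> 'b::topological_space"
  assumes "continuous_map T euclidean g"
  shows "g \<in> borel_measurable (borel_of_topology T)"
proof (rule borel_measurableI)
  fix U :: "'b set" assume "open U"
  then have "openin T {x \<in> topspace T. g x \<in> U}"
    using assms by (auto simp: continuous_map_def)
  moreover have sp: "space (borel_of_topology T) = topspace T"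
    unfolding borel_of_topology_def by (intro space_measure_of) (auto dest: openin_subset)
  moreover have "sets (borel_of_topology T) = sigma_sets (topspace T) {U. openin T U}"
    unfolding borel_of_topology_def by (intro sets_measure_of) (auto dest: openin_subset)
  ultimately show "g -` U \<inter> space (borel_of_topology T) \<in> sets (borel_of_topology T)"
    by (auto simp: vimage_def Int_def conj_commute)
qed

section \<open>The hitting distribution\<close>

context self_similar_walk
begin

text \<open>Both sides are limits of the same numbers, the means of \<open>F \<circ> \<iota>\<close> under the exit laws of the
  sets of vertices below level \<open>n\<close>, where \<open>F\<close> is a continuous extension of \<open>f \<circ> \<kappa>\<close> to the
  compactification. The walk turns them into the mean of \<open>f \<circ> \<kappa>\<close> at its limit; a random address
  turns them into the mean of \<open>f\<close> at the point that the address codes.\<close>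

lemma integral_hitting_point:
  assumes mc: "markov_chain M X (transition X c) [] Z"
    and comp: "compactification X T \<iota>"
    and \<kappa>: "canonical_identification N S r K \<gamma> T \<iota> \<kappa>"
    and Zinf: "Zinf \<in> measurable M (borel_of_topology (boundary X T \<iota>))"
    and lim: "AE \<omega> in M. limitin T (\<lambda>n. \<iota> (Z n \<omega>)) (Zinf \<omega>) sequentially"
    and \<mu>: "self_similar_measure N S p \<mu>"
    and lip: "C-lipschitz_on UNIV f" and f: "\<And>x. 0 \<le> f x \<and> f x \<le> (1::real)"
  shows "(\<integral>\<omega>. f (\<kappa> (Zinf \<omega>)) \<partial>M) = (\<integral>x. f x \<partial>\<mu>)"
proof -
  interpret M: prob_space M using mc by (simp add: markov_chain_def)
  let ?bd = "boundary X T \<iota>"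
  have [measurable]: "Z n \<in> measurable M (count_space UNIV)" for n
    using mc measurable_compose[of "Z n" M "count_space X" "\<lambda>x. x" "count_space UNIV"]
    by (simp add: markov_chain_def)
  have ZX: "Z n \<omega> \<in> X" if "\<omega> \<in> space M" for n \<omega>
    using mc that measurable_space[of "Z n" M "count_space X"] by (simp add: markov_chain_def)
  have H: "Hausdorff_space T" using comp by (simp add: compactification_def)
  have \<iota>X: "\<iota> ` X \<subseteq> topspace T" using compactification_openin_image[OF comp] by (rule openin_subset)
  have bd: "topspace ?bd = topspace T - \<iota> ` X" by (auto simp: boundary_def)
  have cont_f: "continuous_on UNIV f" using lip by (rule lipschitz_on_continuous_on)
  then have [measurable]: "f \<in> borel_measurable borel" by (rule borel_measurable_continuous_onI)
  have cont_\<kappa>: "continuous_map ?bd euclidean \<kappa>"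
    using \<kappa> by (auto simp: canonical_identification_def continuous_map_in_subtopology
        dest!: homeomorphic_imp_continuous_map)
  then have "continuous_map ?bd euclideanreal (f \<circ> \<kappa>)"
    using cont_f by (intro continuous_map_compose[of _ euclidean]) auto
  then obtain F where F: "continuous_map T euclideanreal F"
      and F_bd: "\<And>z. z \<in> topspace ?bd \<Longrightarrow> F z = f (\<kappa> z)"
      and F_01: "\<And>z. z \<in> topspace T \<Longrightarrow> 0 \<le> F z \<and> F z \<le> 1"
    using extension_from_boundary[OF comp, of "f \<circ> \<kappa>"] f by auto
  have F_lim: "(\<lambda>n. F (u n)) \<longlonglongrightarrow> F z" if "limitin T u z sequentially" for u z
    using continuous_map_limit[OF F that] by (simp add: comp_def)
  \<comment> \<open>values between 0 and 1 are required for all words, while \<open>\<iota>\<close> is controlled on \<open>X\<close> only\<close>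
  define G where "G x = (if x \<in> X then F (\<iota> x) else 0)" for x
  have G: "0 \<le> G x" "G x \<le> 1" for x using F_01[of "\<iota> x"] \<iota>X by (auto simp: G_def)
  have Zinf_bd: "Zinf \<omega> \<in> topspace ?bd" if "\<omega> \<in> space M" for \<omega>
  proof -
    have "space (borel_of_topology ?bd) = topspace ?bd"
      unfolding borel_of_topology_def by (intro space_measure_of) (auto dest: openin_subset)
    then show ?thesis using measurable_space[OF Zinf that] by simp
  qed
  have leaves: "AE \<omega> in M. \<forall>n. \<exists>j. Z j \<omega> \<notin> below n"
    using lim
  proof (rule AE_mp, intro AE_I2 impI allI)
    fix \<omega> n assume \<omega>: "\<omega> \<in> space M" "limitin T (\<lambda>n. \<iota> (Z n \<omega>)) (Zinf \<omega>) sequentially"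
    have "eventually (\<lambda>j. Z j \<omega> \<notin> below n) sequentially"
      using limitin_boundary_leaves_finite[OF H \<omega>(2) _ finite_below below_subset_X \<iota>X]
        Zinf_bd[OF \<omega>(1)] bd by simp
    then show "\<exists>j. Z j \<omega> \<notin> below n" by (rule eventually_happens'[OF sequentially_bot])
  qed
  define \<tau> where "\<tau> n \<omega> = (LEAST j. Z j \<omega> \<notin> below n)" for n \<omega>
  have [measurable]: "\<tau> n \<in> measurable M (count_space UNIV)" for n unfolding \<tau>_def by measurable
  have [measurable]: "(\<lambda>\<omega>. Z (\<tau> n \<omega>) \<omega>) \<in> measurable M (count_space UNIV)" for n
    by (rule measurable_compose_countable[where g="\<tau> n"]) measurable
  have tau_lim: "filterlim (\<lambda>n. \<tau> n \<omega>) at_top sequentially"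
    if \<omega>: "\<omega> \<in> space M" "\<forall>n. \<exists>j. Z j \<omega> \<notin> below n" for \<omega>
    unfolding filterlim_at_top
  proof
    fix k
    \<comment> \<open>the first \<open>k\<close> steps stay on levels below \<open>m\<close>\<close>
    define m where "m = (\<Sum>j\<le>k. Suc (level N r (Z j \<omega>)))"
    have "Z j \<omega> \<in> below n" if "j \<le> k" "m \<le> n" for j n
    proof -
      have "Suc (level N r (Z j \<omega>)) \<le> m" unfolding m_def using that(1) by (intro member_le_sum) auto
      then have "level N r (Z j \<omega>) < n" using that(2) by simp
      then show ?thesis unfolding below_def using tree_vertices_level[OF ZX[OF \<omega>(1), of j]] by blast
    qed
    moreover have "Z (\<tau> n \<omega>) \<omega> \<notin> below n" for n
    proof -
      have "\<exists>j. Z j \<omega> \<notin> below n" using \<omega>(2) by blast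
      then show ?thesis unfolding \<tau>_def by (rule LeastI_ex)
    qed
    ultimately have "k \<le> \<tau> n \<omega>" if "m \<le> n" for n using that nat_le_linear by blast
    then show "eventually (\<lambda>n. k \<le> \<tau> n \<omega>) sequentially"
      unfolding eventually_sequentially by blast
  qed
  have walk: "(\<lambda>n. \<integral>\<omega>. G (Z (\<tau> n \<omega>) \<omega>) \<partial>M) \<longlonglongrightarrow> (\<integral>\<omega>. f (\<kappa> (Zinf \<omega>)) \<partial>M)"
  proof (rule integral_dominated_convergence[where w="\<lambda>_. 1"])
    show "(\<lambda>\<omega>. f (\<kappa> (Zinf \<omega>))) \<in> borel_measurable M"
      using measurable_compose[OF measurable_compose[OF Zinf
          continuous_map_measurable_borel_of_topology[OF cont_\<kappa>]] \<open>f \<in> borel_measurable borel\<close>] .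
    show "AE \<omega> in M. (\<lambda>n. G (Z (\<tau> n \<omega>) \<omega>)) \<longlonglongrightarrow> f (\<kappa> (Zinf \<omega>))"
      using AE_conjI[OF lim leaves]
    proof (rule AE_mp, intro AE_I2 impI)
      fix \<omega> assume \<omega>: "\<omega> \<in> space M"
        "limitin T (\<lambda>n. \<iota> (Z n \<omega>)) (Zinf \<omega>) sequentially \<and> (\<forall>n. \<exists>j. Z j \<omega> \<notin> below n)"
      have "(\<lambda>n. F (\<iota> (Z n \<omega>))) \<longlonglongrightarrow> f (\<kappa> (Zinf \<omega>))"
        using F_lim[OF conjunct1[OF \<omega>(2)]] F_bd[OF Zinf_bd[OF \<omega>(1)]] by simp
      then have "(\<lambda>n. F (\<iota> (Z (\<tau> n \<omega>) \<omega>))) \<longlonglongrightarrow> f (\<kappa> (Zinf \<omega>))"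
        using filterlim_compose tau_lim \<omega> by blast
      then show "(\<lambda>n. G (Z (\<tau> n \<omega>) \<omega>)) \<longlonglongrightarrow> f (\<kappa> (Zinf \<omega>))"
        using ZX[OF \<omega>(1)] by (simp add: G_def)
    qed
  qed (use G in auto)
  obtain \<xi> where \<xi>: "\<xi> \<in> K" using attractor by (auto simp: self_similar_set_def)
  have coded: "(\<lambda>n. G (cut n s) - f (word_map S (stake n s) \<xi>)) \<longlonglongrightarrow> 0" if s: "sset s \<subseteq> {1..N}" for s
  proof -
    obtain \<zeta> where \<zeta>: "\<zeta> \<in> topspace ?bd" "limitin T (\<lambda>n. \<iota> (cut n s)) \<zeta> sequentially"
        "(\<Inter>n. word_map S (cut n s) ` K) = {\<kappa> \<zeta>}"
      using \<kappa> geodesic_ray_cut[OF s] unfolding canonical_identification_def by blast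
    have "(\<lambda>n. F (\<iota> (cut n s))) \<longlonglongrightarrow> f (\<kappa> \<zeta>)" using F_lim[OF \<zeta>(2)] F_bd[OF \<zeta>(1)] by simp
    moreover have "cut n s \<in> X" for n using cut_in_level_set[OF s] level_set_subset_X by blast
    ultimately have "(\<lambda>n. G (cut n s)) \<longlonglongrightarrow> f (\<kappa> \<zeta>)" by (simp add: G_def)
    moreover have "(\<lambda>n. f (word_map S (stake n s) \<xi>)) \<longlonglongrightarrow> f (\<kappa> \<zeta>)"
    proof (rule continuous_on_tendsto_compose[OF cont_f])
      show "(\<lambda>n. word_map S (stake n s) \<xi>) \<longlonglongrightarrow> \<kappa> \<zeta>"
        using \<zeta>(3) by (intro word_map_stake_tendsto[OF s \<xi>]) simp
    qed auto
    ultimately have "(\<lambda>n. G (cut n s) - f (word_map S (stake n s) \<xi>)) \<longlonglongrightarrow> f (\<kappa> \<zeta>) - f (\<kappa> \<zeta>)"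
      by (rule tendsto_diff)
    then show ?thesis by simp
  qed
  have [measurable]: "(\<lambda>s. G (cut n s)) \<in> borel_measurable addresses"
    "(\<lambda>s. f (word_map S (stake n s) \<xi>)) \<in> borel_measurable addresses" for n
    by (rule measurable_compose[OF cut_measurable] measurable_compose[OF stake_measurable], simp)+
  have "(\<lambda>n. \<integral>s. G (cut n s) - f (word_map S (stake n s) \<xi>) \<partial>addresses) \<longlonglongrightarrow> (\<integral>s. 0 \<partial>addresses)"
  proof (rule integral_dominated_convergence[where w="\<lambda>_. 1"])
    show "AE s in addresses. (\<lambda>n. G (cut n s) - f (word_map S (stake n s) \<xi>)) \<longlonglongrightarrow> 0"
      using AE_addresses by eventually_elim (rule coded)
    show "AE s in addresses. norm (G (cut n s) - f (word_map S (stake n s) \<xi>)) \<le> 1" for n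
    proof (rule AE_I2)
      fix s
      show "norm (G (cut n s) - f (word_map S (stake n s) \<xi>)) \<le> 1"
        using G[of "cut n s"] f[of "word_map S (stake n s) \<xi>"] by (simp add: abs_le_iff)
    qed
  qed auto
  moreover have "(\<integral>s. G (cut n s) - f (word_map S (stake n s) \<xi>) \<partial>addresses)
      = (\<integral>s. G (cut n s) \<partial>addresses) - (\<integral>s. f (word_map S (stake n s) \<xi>) \<partial>addresses)" for n
    using G f by (intro Bochner_Integration.integral_diff addresses.integrable_const_bound[where B=1]) auto
  ultimately have "(\<lambda>n. (\<integral>s. G (cut n s) \<partial>addresses) - (\<integral>s. f (word_map S (stake n s) \<xi>) \<partial>addresses)) \<longlonglongrightarrow> 0"
    by simp
  from tendsto_add[OF this integral_words_tendsto[OF \<mu> lip f, of \<xi>]]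
  have coding: "(\<lambda>n. \<integral>s. G (cut n s) \<partial>addresses) \<longlonglongrightarrow> (\<integral>x. f x \<partial>\<mu>)" by simp
  have "(\<integral>\<omega>. G (Z (\<tau> n \<omega>) \<omega>) \<partial>M) = (\<integral>s. G (cut n s) \<partial>addresses)" if "n > 0" for n
    unfolding integral_cut \<tau>_def
  proof (rule exit_law[OF mc _ that G])
    show "AE \<omega> in M. \<exists>j. Z j \<omega> \<notin> below n" using leaves by eventually_elim blast
  qed
  then have "eventually (\<lambda>n. (\<integral>s. G (cut n s) \<partial>addresses) = (\<integral>\<omega>. G (Z (\<tau> n \<omega>) \<omega>) \<partial>M)) sequentially"
    by (intro eventually_mono[OF eventually_gt_at_top[of 0]]) (rule sym)
  with coding have "(\<lambda>n. \<integral>\<omega>. G (Z (\<tau> n \<omega>) \<omega>) \<partial>M) \<longlonglongrightarrow> (\<integral>x. f x \<partial>\<mu>)"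
    by (rule Lim_transform_eventually)
  then show ?thesis using walk LIMSEQ_unique by blast
qed

end

theorem theorem5p6:
  fixes N :: nat
    and S :: "nat \<Rightarrow> 'a::euclidean_space \<Rightarrow> 'a"
    and r p :: "nat \<Rightarrow> real"
    and K :: "'a set"
    and lam \<gamma> :: real
    and c :: "nat list \<Rightarrow> nat list \<Rightarrow> real"
    and \<Omega> :: "'w measure"
    and Z :: "nat \<Rightarrow> 'w \<Rightarrow> nat list"
    and T :: "'t topology"
    and \<iota> :: "nat list \<Rightarrow> 't"
    and \<kappa> :: "'t \<Rightarrow> 'a"
    and \<nu> :: "'t measure"
    and \<mu> :: "'a measure"
  assumes "N \<ge> 2"
    and "\<And>i. i \<in> {1..N} \<Longrightarrow> contractive_similitude (S i) (r i)"
    and "open_set_condition N S"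
    and "self_similar_set N S K"
    and "\<And>i. i \<in> {1..N} \<Longrightarrow> 0 < p i"
    and "(\<Sum>i=1..N. p i) = 1"
    and "0 < lam" and "lam < 1" and "0 < \<gamma>"
    and "qnrw_conductance N S r K \<gamma> p lam c"
    and "markov_chain \<Omega> (tree_vertices N r) (transition (tree_vertices N r) c) [] Z"
    and "martin_compactification (tree_vertices N r) (transition (tree_vertices N r) c) [] T \<iota>"
    and "canonical_identification N S r K \<gamma> T \<iota> \<kappa>"
    and "hitting_distribution \<Omega> Z (tree_vertices N r) T \<iota> \<nu>"
    and "self_similar_measure N S p \<mu>"
  shows "distr \<nu> borel \<kappa> = \<mu>"
proof -
  interpret self_similar_walk N r p S K \<gamma> lam c
  proof
    show "0 < r i" "r i < 1" "0 < p i" "contractive_similitude (S i) (r i)" if "i \<in> {1..N}" for i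
      using assms(2)[OF that] assms(5)[OF that] by (auto simp: contractive_similitude_def)
  qed (use assms(1,4,6,7,10) in auto)
  obtain Zinf where Zinf: "Zinf \<in> measurable \<Omega> (borel_of_topology (boundary X T \<iota>))"
      and lim: "AE \<omega> in \<Omega>. limitin T (\<lambda>n. \<iota> (Z n \<omega>)) (Zinf \<omega>) sequentially"
      and \<nu>: "\<nu> = distr \<Omega> (borel_of_topology (boundary X T \<iota>)) Zinf"
    using assms(14) unfolding hitting_distribution_def by blast
  have comp: "compactification X T \<iota>" using assms(12) by (simp add: martin_compactification_def)
  have "prob_space \<Omega>" using assms(11) by (simp add: markov_chain_def)
  have "continuous_map (boundary X T \<iota>) euclidean \<kappa>"
    using assms(13) by (auto simp: canonical_identification_def continuous_map_in_subtopology
        dest!: homeomorphic_imp_continuous_map)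
  then have \<kappa>: "\<kappa> \<in> borel_measurable (borel_of_topology (boundary X T \<iota>))"
    by (rule continuous_map_measurable_borel_of_topology)
  have \<kappa>Z: "(\<lambda>\<omega>. \<kappa> (Zinf \<omega>)) \<in> borel_measurable \<Omega>" using measurable_compose[OF Zinf \<kappa>] .
  have distr: "distr \<nu> borel \<kappa> = distr \<Omega> borel (\<lambda>\<omega>. \<kappa> (Zinf \<omega>))"
    unfolding \<nu> distr_distr[OF \<kappa> Zinf] comp_def ..
  show ?thesis
    unfolding distr
  proof (rule measure_eqI_lipschitz)
    show "prob_space (distr \<Omega> borel (\<lambda>\<omega>. \<kappa> (Zinf \<omega>)))"
      using \<kappa>Z \<open>prob_space \<Omega>\<close> by (intro prob_space.prob_space_distr)
    show "prob_space \<mu>" "sets \<mu> = sets borel"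
      using assms(15) by (auto simp: self_similar_measure_def)
    fix f :: "'a \<Rightarrow> real" and C
    assume lip: "C-lipschitz_on UNIV f" and f: "\<And>x. 0 \<le> f x \<and> f x \<le> 1"
    have "f \<in> borel_measurable borel"
      using lip by (intro borel_measurable_continuous_onI lipschitz_on_continuous_on)
    then show "(\<integral>x. f x \<partial>distr \<Omega> borel (\<lambda>\<omega>. \<kappa> (Zinf \<omega>))) = (\<integral>x. f x \<partial>\<mu>)"
      using integral_hitting_point[OF assms(11) comp assms(13) Zinf lim assms(15) lip f]
      by (simp add: integral_distr[OF \<kappa>Z])
  qed simp
qed

end
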